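(* Let $I=[0,1]$ and let $F:I\to\mathbb{R}$ be a non-linear differentiable Lipschitz function such that $F'$ has the Luzin N property. Then for any set $X$ of lines in $\mathbb{R}^2$ with $\operatorname{graph}(F)\subset\bigcup X$, the union $\bigcup X$ has Hausdorff dimension $2$.
   Context: A function is said to have the Luzin N property if it maps sets of Lebesgue measure zero to sets of Lebesgue measure zero. "Non-linear" means that $F$ is not of the form $F(x)=ax+b$ on $[0,1]$, i.e. its graph is not contained in a line. $\operatorname{graph}(F)=\{(x,F(x)) : x\in I\}\subset\mathbb{R}^2$. Differentiability at the endpoints is one-sided. *)

theory Defs
  imports "HOL-Analysis.Analysis"
begin

definition luzin_N_on :: "'a::euclidean_space set \<Rightarrow> ('a \<Rightarrow> 'b::euclidean_space) \<Rightarrow> bool" where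
  "luzin_N_on S f \<longleftrightarrow>
     (\<forall>N. N \<subseteq> S \<and> N \<in> null_sets lebesgue \<longrightarrow> f ` N \<in> null_sets lebesgue)"

definition is_line :: "'a::euclidean_space set \<Rightarrow> bool" where
  "is_line L \<longleftrightarrow> affine L \<and> aff_dim L = 1"

definition graph_on :: "'a set \<Rightarrow> ('a \<Rightarrow> 'b) \<Rightarrow> ('a \<times> 'b) set" where
  "graph_on S f = {(x, f x) | x. x \<in> S}"

(* The summand diam(U)^s, with the usual conventions that the empty set contributes 0
   and diam(U)^0 = 1 for nonempty U; "powr" alone would give 0 for a singleton at s = 0. *)
definition diam_power :: "real \<Rightarrow> 'a::metric_space set \<Rightarrow> ennreal" where
  "diam_power s U =
     (if U = {} then 0 else if s = 0 then 1 else ennreal (diameter U powr s))"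

(* Boundedness is required explicitly because "diameter" is a real number and
   carries no information for unbounded sets. *)
definition hausdorff_premeasure :: "real \<Rightarrow> real \<Rightarrow> 'a::metric_space set \<Rightarrow> ennreal" where
  "hausdorff_premeasure s \<delta> E =
     (INF U \<in> {U :: nat \<Rightarrow> 'a set. E \<subseteq> (\<Union>i. U i) \<and> (\<forall>i. bounded (U i) \<and> diameter (U i) \<le> \<delta>)}.
        \<Sum>i. diam_power s (U i))"

(* Unnormalised Hausdorff outer measure: the normalising constant does not affect dimension. *)
definition hausdorff_measure :: "real \<Rightarrow> 'a::metric_space set \<Rightarrow> ennreal" where
  "hausdorff_measure s E = (SUP \<delta> \<in> {0<..}. hausdorff_premeasure s \<delta> E)"

(* Extended-valued, so that a set with no finite s of zero measure has dimension infinity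
   (the infimum of the empty set). *)
definition hausdorff_dim :: "'a::metric_space set \<Rightarrow> ennreal" where
  "hausdorff_dim E = Inf {ennreal s | s. 0 \<le> s \<and> hausdorff_measure s E = 0}"

end

theory Submission
  imports Defs
begin

text \<open>
  Every point \<^term>\<open>(x, F x)\<close> of the graph lies on a line of the family. The proof extracts from these
  lines a subfamily, indexed by a set \<open>A\<close> of reals of positive outer measure, in which the distance
  between two lines, measured by their slopes and intercepts, is at least a constant times the
  distance of their indices. Any union of lines containing such a one-parameter family has dimension
  2 (\<open>hausdorff_measure_union_of_lines_nonzero\<close>).

  To find the subfamily, sort the points \<open>x\<close> of \<open>[0, 1]\<close> by the chosen line through \<open>(x, F x)\<close>.
  If vertical lines occur on a non-null set, \<open>x\<close> itself is the index. If transversal lines occur on a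
  non-null set, countably many pieces suffice to make the transversality quantitative: on one
  non-null piece, the line chosen for \<open>x\<close> misses every other point \<open>(y, F y)\<close> of the piece by at least
  \<open>c \<bar>x - y\<bar>\<close>, while the line chosen for \<open>y\<close> passes through it, so the two lines are that far apart
  (\<open>transversal_separated_piece\<close>). In the remaining case the chosen line is the tangent for almost
  every \<open>x\<close>. As \<open>F\<close> is not affine, \<open>F'\<close> is not constant, so by Darboux its image contains an interval;
  by the Luzin property the exceptional null set of points contributes only a null set of slopes.
  Hence the tangents in the family have a non-null set of slopes, and the slope is the index.

  The dimension of the union of a separated family is bounded below by Cordoba's \<open>L\<^sup>2\<close> argument,
  carried out by counting dyadic squares, which avoids any measurability question about \<open>A\<close> or the
  covering sets. Given a cover of small \<open>s\<close>-dimensional sum with \<open>s < 2\<close>, one sorts its members by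
  dyadic diameter \<open>2\<^sup>-\<^sup>k\<close>. Two applications of a pigeonhole principle (\<open>dyadic_pigeonhole\<close>) produce one
  scale \<open>k\<close> at which nearly \<open>2\<^sup>k\<close> lines, with indices in distinct intervals of length \<open>2\<^sup>-\<^sup>k\<close>, each meet the cover in nearly
  \<open>2\<^sup>k\<close> squares of side \<open>2\<^sup>-\<^sup>k\<close>. Two lines at distance \<open>d\<close> share at most about \<open>1/d\<close> such squares, so by
  Cauchy-Schwarz the total number of squares is nearly \<open>4\<^sup>k\<close> (\<open>kakeya_counting\<close>). This forces so many
  covering sets of diameter \<open>2\<^sup>-\<^sup>k\<close> that their \<open>s\<close>-dimensional sum cannot be small
  (\<open>kakeya_content_bound\<close>).
\<close>

section \<open>Incidences between lines and dyadic squares\<close>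

text \<open>Cauchy-Schwarz applied to the sizes of the fibres of \<open>f\<close>: a map into a small set must have many
  colliding pairs.\<close>

lemma card_squared_le_collisions:
  assumes "finite I" "finite Q" "f ` I \<subseteq> Q"
  shows "(real (card I))\<^sup>2 \<le> real (card Q) * real (card {(p, p'). p \<in> I \<and> p' \<in> I \<and> f p = f p'})"
proof -
  define fib where "fib c = {p \<in> I. f p = c}" for c
  have fin: "finite (fib c)" for c using assms unfolding fib_def by auto
  have I: "I = (\<Union>c\<in>Q. fib c)" using assms unfolding fib_def by auto
  have "card (\<Union>c\<in>Q. fib c) = (\<Sum>c\<in>Q. card (fib c))"
    by (rule card_UN_disjoint) (use assms fin in \<open>auto simp: fib_def\<close>)
  then have 1: "card I = (\<Sum>c\<in>Q. card (fib c))" using I by (rule back_subst[of "\<lambda>X. card X = _", OF _ sym])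
  have "{(p, p'). p \<in> I \<and> p' \<in> I \<and> f p = f p'} = (\<Union>c\<in>Q. fib c \<times> fib c)"
    using assms unfolding fib_def by auto
  moreover have "card (\<Union>c\<in>Q. fib c \<times> fib c) = (\<Sum>c\<in>Q. card (fib c \<times> fib c))"
    by (rule card_UN_disjoint) (use assms fin in \<open>auto simp: fib_def\<close>)
  ultimately have 2: "card {(p, p'). p \<in> I \<and> p' \<in> I \<and> f p = f p'} = (\<Sum>c\<in>Q. (card (fib c))\<^sup>2)"
    by (simp add: card_cartesian_product power2_eq_square)
  show ?thesis
    using sum_squared_le_sum_of_squares[of "\<lambda>c. real (card (fib c))" Q]
    unfolding 1 2 by (simp add: mult.commute)
qed

text \<open>The affine function \<open>x \<mapsto> a x + b\<close> can be at most \<open>C / n\<close> at few of the points \<open>m / n\<close> of \<open>[0, 1)\<close>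
  unless its coefficients are small. If it is that small somewhere and \<open>d\<close> is large against \<open>C / n\<close>,
  its slope is at least \<open>d / 4\<close>, so the points where it is small span a length of at most
  \<open>8 C / (d n)\<close>. If \<open>d\<close> is not that large, the bound exceeds the number \<open>n\<close> of points. The inequality is
  multiplied by \<open>n\<close> in the statement.\<close>

lemma card_affine_small:
  fixes a b C d :: real and n :: int
  assumes "0 < d" "d \<le> \<bar>a\<bar> + \<bar>b\<bar>" "0 < C" "1 \<le> n"
  shows "real (card {m \<in> {0..<n}. \<bar>a * m + b * n\<bar> \<le> C}) \<le> 1 + 8 * C / d"
proof -
  define S where "S = {m \<in> {0..<n}. \<bar>a * m + b * n\<bar> \<le> C}"
  have "S \<subseteq> {0..<n}" unfolding S_def by auto
  then have fin: "finite S" by (rule finite_subset) simp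
  consider "d * n < 2 * C" | "S = {}" | "d * n \<ge> 2 * C" "S \<noteq> {}" by linarith
  then have "real (card S) \<le> 1 + 8 * C / d"
  proof cases
    case 1
    have "card S \<le> card {0..<n}" unfolding S_def by (intro card_mono) auto
    then have "real (card S) \<le> n" using assms by simp
    also have "\<dots> \<le> 2 * C / d" using 1 assms by (simp add: field_simps)
    also have "\<dots> \<le> 1 + 8 * C / d" using assms by (simp add: field_simps)
    finally show ?thesis .
  next
    case 2
    then show ?thesis using assms by simp
  next
    case 3
    define u v where "u = Min S" and "v = Max S"
    have uv: "u \<in> S" "v \<in> S" "S \<subseteq> {u..v}" using 3 fin unfolding u_def v_def by auto
    have le: "\<bar>a * u + b * n\<bar> \<le> C" "\<bar>a * v + b * n\<bar> \<le> C" "0 \<le> u" "u < n" "u \<le> v"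
      using uv unfolding S_def by auto
    have "\<bar>a * u\<bar> \<le> \<bar>a\<bar> * n" using le unfolding abs_mult by (intro mult_left_mono) auto
    moreover have "\<bar>b * n\<bar> \<le> C + \<bar>a * u\<bar>" using le by linarith
    ultimately have "\<bar>b\<bar> * n \<le> C + \<bar>a\<bar> * n" using le assms by (simp add: abs_mult)
    moreover have "d * n \<le> (\<bar>a\<bar> + \<bar>b\<bar>) * n" using assms by (intro mult_right_mono) auto
    ultimately have "d * n \<le> 4 * \<bar>a\<bar> * n" using 3 by (simp add: algebra_simps)
    then have a: "d \<le> 4 * \<bar>a\<bar>" using assms by simp
    have "\<bar>a\<bar> * (v - u) = \<bar>a * (v - u)\<bar>" using le unfolding abs_mult by simp
    also have "\<dots> \<le> 2 * C" using le by (simp add: algebra_simps)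
    finally have "\<bar>a\<bar> * (v - u) \<le> 2 * C" .
    moreover have "d * (v - u) \<le> 4 * \<bar>a\<bar> * (v - u)" using le a by (intro mult_right_mono) auto
    ultimately have vu: "real_of_int (v - u) \<le> 8 * C / d" using assms by (simp add: field_simps)
    have "card S \<le> card {u..v}" using uv by (intro card_mono) auto
    then have "real (card S) \<le> 1 + real_of_int (v - u)" using le by simp
    then show ?thesis using vu by linarith
  qed
  then show ?thesis unfolding S_def .
qed

lemma harmonic_dyadic_le: "(\<Sum>i<(2::nat)^k. 1 / (real i + 1)) \<le> real k + 1"
proof (induction k)
  case (Suc k)
  have "{..<(2::nat)^Suc k} = {..<2^k} \<union> {2^k..<2^Suc k}" by (rule ivl_disj_un_one(2)[symmetric]) simp
  then have "(\<Sum>i<(2::nat)^Suc k. 1 / (real i + 1)) =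
     (\<Sum>i<(2::nat)^k. 1 / (real i + 1)) + (\<Sum>i\<in>{2^k..<(2::nat)^Suc k}. 1 / (real i + 1))"
    using sum.union_disjoint[of "{..<(2::nat)^k}" "{2^k..<2^Suc k}" "\<lambda>i. 1 / (real i + 1)"]
    by (simp add: disjoint_iff)
  also have "(\<Sum>i\<in>{2^k..<(2::nat)^Suc k}. 1 / (real i + 1)) \<le> real (card {2^k..<(2::nat)^Suc k}) * (1 / 2^k)"
  proof (rule sum_bounded_above)
    fix i assume "i \<in> {2^k..<(2::nat)^Suc k}"
    then have "(2::nat)^k \<le> i" by simp
    then have "(2::real)^k \<le> real i" by (metis of_nat_le_iff of_nat_numeral of_nat_power)
    then have "(2::real)^k \<le> real i + 1" by linarith
    then show "1 / (real i + 1) \<le> 1 / 2 ^ k" by (intro divide_left_mono) auto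
  qed
  also have "real (card {2^k..<(2::nat)^Suc k}) * (1 / 2^k) = 1" by simp
  finally show ?case using Suc by simp
qed simp

lemma sum_inverse_distance_le:
  fixes J :: "int set" and j :: int
  assumes "J \<subseteq> {0..<2^k}" "j \<in> {0..<2^k}"
  shows "(\<Sum>i\<in>J. 1 / (\<bar>real_of_int (j - i)\<bar> + 1)) \<le> 2 * (real k + 1)"
proof -
  have fin: "finite J" using assms finite_subset by blast
  have *: "(\<Sum>i\<in>J'. 1 / (\<bar>real_of_int (j - i)\<bar> + 1)) \<le> real k + 1"
    if J': "J' \<subseteq> J" and inj: "inj_on (\<lambda>i. nat \<bar>j - i\<bar>) J'" for J'
  proof -
    have "(\<Sum>i\<in>J'. 1 / (\<bar>real_of_int (j - i)\<bar> + 1)) = (\<Sum>i\<in>J'. 1 / (real (nat \<bar>j - i\<bar>) + 1))"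
      by (intro sum.cong) auto
    also have "\<dots> = (\<Sum>i\<in>(\<lambda>i. nat \<bar>j - i\<bar>) ` J'. 1 / (real i + 1))"
      using inj by (simp add: sum.reindex)
    also have "\<dots> \<le> (\<Sum>i<(2::nat)^k. 1 / (real i + 1))"
    proof (intro sum_mono2)
      show "(\<lambda>i. nat \<bar>j - i\<bar>) ` J' \<subseteq> {..<2^k}"
      proof safe
        fix i assume "i \<in> J'"
        then have "0 \<le> i" "i < 2^k" "0 \<le> j" "j < 2^k" using assms J' by auto
        then have "\<bar>j - i\<bar> < 2^k" by linarith
        then show "nat \<bar>j - i\<bar> < 2^k" by (simp add: nat_less_iff)
      qed
    qed auto
    also have "\<dots> \<le> real k + 1" by (rule harmonic_dyadic_le)
    finally show ?thesis .
  qed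
  have "J = {i\<in>J. i \<le> j} \<union> {i\<in>J. i > j}" by auto
  then have "(\<Sum>i\<in>J. 1 / (\<bar>real_of_int (j - i)\<bar> + 1)) =
      (\<Sum>i\<in>{i\<in>J. i \<le> j}. 1 / (\<bar>real_of_int (j - i)\<bar> + 1)) + (\<Sum>i\<in>{i\<in>J. i > j}. 1 / (\<bar>real_of_int (j - i)\<bar> + 1))"
    by (metis (no_types, lifting) sum.union_disjoint fin finite_Un disjoint_iff mem_Collect_eq not_le)
  also have "\<dots> \<le> (real k + 1) + (real k + 1)"
    by (intro add_mono *) (auto simp: inj_on_def)
  finally show ?thesis by simp
qed

definition dyadic_cell :: "nat \<Rightarrow> real \<times> real \<Rightarrow> int \<times> int" where
  "dyadic_cell k p = (\<lfloor>2^k * fst p\<rfloor>, \<lfloor>2^k * snd p\<rfloor>)"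

definition dyadic_columns :: "nat \<Rightarrow> (real \<times> real) set \<Rightarrow> real \<Rightarrow> real \<Rightarrow> int set" where
  "dyadic_columns k G a b = (\<lambda>x. \<lfloor>2^k * x\<rfloor>) ` {x \<in> {0..<1}. (x, a * x + b) \<in> G}"

lemma dyadic_index:
  assumes "x \<in> {0..<(1::real)}"
  shows "\<lfloor>2^k * x\<rfloor> \<in> {0..<2^k}"
  using assms by (simp add: floor_less_iff)

lemma dyadic_columns_subset: "dyadic_columns k G a b \<subseteq> {0..<2^k}"
  unfolding dyadic_columns_def by (auto simp: floor_less_iff)

text \<open>If two lines pass through the same dyadic square of column \<open>m\<close>, their heights over the left edge of
  that column differ by at most \<open>(1 + 2 B) / 2\<^sup>k\<close>: in units of \<open>2\<^sup>-\<^sup>k\<close>, the side of the square accounts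
  for 1 and the drift of either line within the column for at most \<open>B\<close>. Columns with this property are few by \<open>card_affine_small\<close>.\<close>

lemma card_common_cells:
  assumes "\<bar>a\<bar> \<le> B" "\<bar>a'\<bar> \<le> B" "0 < d" "d \<le> \<bar>a - a'\<bar> + \<bar>b - b'\<bar>"
  shows "real (card {m \<in> {0..<2^k}. \<exists>x x'. \<lfloor>2^k * x\<rfloor> = m \<and> \<lfloor>2^k * x'\<rfloor> = m \<and>
            \<lfloor>2^k * (a * x + b)\<rfloor> = \<lfloor>2^k * (a' * x' + b')\<rfloor>}) \<le> 1 + 8 * (1 + 2 * B) / d"
    (is "real (card ?S) \<le> _")
proof -
  have B: "0 \<le> B" using assms by linarith
  have "?S \<subseteq> {m \<in> {0..<2^k}. \<bar>(a - a') * real_of_int m + (b - b') * (2^k :: int)\<bar> \<le> 1 + 2 * B}"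
  proof safe
    fix m :: int and x x' :: real
    assume m: "m = \<lfloor>2^k * x\<rfloor>" "\<lfloor>2^k * x'\<rfloor> = \<lfloor>2^k * x\<rfloor>" "\<lfloor>2^k * (a * x + b)\<rfloor> = \<lfloor>2^k * (a' * x' + b')\<rfloor>"
    define th th' where "th = 2^k * x - \<lfloor>2^k * x\<rfloor>" and "th' = 2^k * x' - \<lfloor>2^k * x\<rfloor>"
    have th: "0 \<le> th" "th \<le> 1" "0 \<le> th'" "th' \<le> 1"
      using m(2) unfolding th_def th'_def by linarith+
    have "\<bar>a\<bar> * \<bar>th\<bar> \<le> B * 1"
      by (rule mult_mono) (use th assms(1) B in simp_all)
    moreover have "\<bar>a'\<bar> * \<bar>th'\<bar> \<le> B * 1"
      by (rule mult_mono) (use th assms(2) B in simp_all)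
    moreover have "\<bar>2^k * (a * x + b) - 2^k * (a' * x' + b')\<bar> \<le> 1"
      using m(3) by linarith
    moreover have "2^k * (a * x + b) - 2^k * (a' * x' + b') =
       (a - a') * \<lfloor>2^k * x\<rfloor> + (b - b') * 2^k + a * th - a' * th'"
      unfolding th_def th'_def by (simp add: algebra_simps)
    ultimately show "\<bar>(a - a') * \<lfloor>2^k * x\<rfloor> + (b - b') * (2^k :: int)\<bar> \<le> 1 + 2 * B"
      unfolding abs_mult[symmetric] by simp
  qed
  then have "card ?S \<le> card {m \<in> {0..<2^k}. \<bar>(a - a') * real_of_int m + (b - b') * (2^k :: int)\<bar> \<le> 1 + 2 * B}"
    by (intro card_mono finite_subset[OF Collect_restrict]) auto
  also have "real \<dots> \<le> 1 + 8 * (1 + 2 * B) / d"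
    using assms B by (intro card_affine_small) auto
  finally show ?thesis by simp
qed

text \<open>The discrete form of Cordoba's argument. An incidence is a pair of a line \<open>j\<close> and a column in which
  it meets \<open>G\<close>; it is mapped to a dyadic square that contains such a meeting point. There are at least
  \<open>|J| w 2\<^sup>k\<close> incidences. Two incidences collide only if they lie in the same column and their lines pass
  through a common square there, which for lines \<open>i\<close> and \<open>j\<close> happens in at most
  \<open>K 2\<^sup>k / (\<bar>i - j\<bar> + 1)\<close> columns; summing this over \<open>j\<close> costs only the harmonic
  factor \<open>k + 1\<close>. Cauchy-Schwarz then bounds the number of squares from below.\<close>

lemma kakeya_counting:
  fixes t a b :: "int \<Rightarrow> real"
  assumes J: "J \<subseteq> {0..<2^k}" and t: "\<And>j. j \<in> J \<Longrightarrow> \<lfloor>2^k * t j\<rfloor> = j"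
    and B: "0 \<le> B" "\<And>j. j \<in> J \<Longrightarrow> \<bar>a j\<bar> \<le> B"
    and c: "0 < c" and sep: "\<And>i j. \<lbrakk>i \<in> J; j \<in> J\<rbrakk> \<Longrightarrow> c * \<bar>t i - t j\<bar> \<le> \<bar>a i - a j\<bar> + \<bar>b i - b j\<bar>"
    and G: "finite (dyadic_cell k ` G)"
    and w: "0 \<le> w" "\<And>j. j \<in> J \<Longrightarrow> w * 2^k \<le> real (card (dyadic_columns k G (a j) (b j)))"
    and K: "K = 2 + 24 * (1 + 2 * B) / c"
  shows "real (card J) * w\<^sup>2 * 2^k \<le> 2 * K * (real k + 1) * real (card (dyadic_cell k ` G))"
proof (cases "J = {}")
  case True
  then show ?thesis using B c K by simp
next
  case False
  define N where "N = real (card J)"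
  define Q where "Q = dyadic_cell k ` G"
  have finJ: "finite J" using J finite_subset by blast
  have N: "N > 0" unfolding N_def using False finJ by (simp add: card_gt_0_iff)
  have K0: "K \<ge> 2" using B c K by simp
  define S where "S j = dyadic_columns k G (a j) (b j)" for j
  have S: "S j \<subseteq> {0..<2^k}" for j unfolding S_def by (rule dyadic_columns_subset)
  then have finS: "finite (S j)" for j using finite_subset by blast
  \<comment> \<open>the abscissa of one meeting point of line \<open>j\<close> with \<open>G\<close> in column \<open>m\<close>\<close>
  define x where "x j m = (SOME x. \<lfloor>2^k * x\<rfloor> = m \<and> (x, a j * x + b j) \<in> G)" for j m
  have x: "\<lfloor>2^k * x j m\<rfloor> = m" "(x j m, a j * x j m + b j) \<in> G" if "m \<in> S j" for j m
  proof -
    from that have "\<exists>x. \<lfloor>2^k * x\<rfloor> = m \<and> (x, a j * x + b j) \<in> G"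
      unfolding S_def dyadic_columns_def by blast
    from someI_ex[OF this] show "\<lfloor>2^k * x j m\<rfloor> = m" "(x j m, a j * x j m + b j) \<in> G"
      unfolding x_def by blast+
  qed
  define f where "f = (\<lambda>(j, m). dyadic_cell k (x j m, a j * x j m + b j))"
  define I where "I = Sigma J S"
  have finI: "finite I" unfolding I_def using finJ finS by auto
  have fQ: "f ` I \<subseteq> Q" unfolding f_def I_def Q_def using x(2) by auto
  have "N * (w * 2^k) \<le> real (\<Sum>j\<in>J. card (S j))"
    unfolding N_def of_nat_sum using w(2) by (intro sum_bounded_below) (auto simp: S_def)
  also have "(\<Sum>j\<in>J. card (S j)) = card I" unfolding I_def using finJ finS by simp
  finally have I: "N * (w * 2^k) \<le> real (card I)" .
  define T where "T i j = {m \<in> {0..<2^k}. \<exists>x x'. \<lfloor>2^k * x\<rfloor> = m \<and> \<lfloor>2^k * x'\<rfloor> = m \<and>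
            \<lfloor>2^k * (a i * x + b i)\<rfloor> = \<lfloor>2^k * (a j * x' + b j)\<rfloor>}" for i j
  have finT: "finite (T i j)" for i j unfolding T_def by (rule finite_subset[OF Collect_restrict]) simp
  have T: "real (card (T i j)) \<le> K * 2^k * (1 / (\<bar>real_of_int (i - j)\<bar> + 1))" if ij: "i \<in> J" "j \<in> J" for i j
  proof -
    have "0 \<le> i" "i < 2^k" "0 \<le> j" "j < 2^k" using ij J by auto
    then have "\<bar>i - j\<bar> + 1 \<le> 2^k" by linarith
    then have "real_of_int (\<bar>i - j\<bar> + 1) \<le> real_of_int (2^k)" by (simp only: of_int_le_iff)
    then have D: "\<bar>real_of_int (i - j)\<bar> + 1 \<le> 2^k" by simp
    show ?thesis
    proof (cases "\<bar>i - j\<bar> \<le> 1")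
      case True
      have "card (T i j) \<le> card {0..<(2::int)^k}" unfolding T_def by (intro card_mono) auto
      also have "card {0..<(2::int)^k} = 2^k" by (simp add: nat_power_eq)
      finally have "real (card (T i j)) \<le> real (2^k)" by (simp only: of_nat_le_iff)
      then have "real (card (T i j)) \<le> 2^k" by simp
      also have "\<dots> = 2 * 2^k * (1/2)" by simp
      also have "\<dots> \<le> K * 2^k * (1 / (\<bar>real_of_int (i - j)\<bar> + 1))"
      proof (intro mult_mono)
        have "\<bar>real_of_int (i - j)\<bar> + 1 \<le> 2" using True by linarith
        then show "1 / 2 \<le> 1 / (\<bar>real_of_int (i - j)\<bar> + 1)" by (intro frac_le) auto
      qed (use K0 in auto)
      finally show ?thesis .
    next
      case False
      define D where "D = \<bar>real_of_int (i - j)\<bar>"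
      have D2: "D \<ge> 2" unfolding D_def using False by linarith
      have "2^k * \<bar>t i - t j\<bar> = \<bar>2^k * t i - 2^k * t j\<bar>"
        by (simp add: abs_mult flip: right_diff_distrib)
      also have "\<dots> \<ge> D - 1" using t[OF ij(1)] t[OF ij(2)] unfolding D_def by linarith
      finally have "(D + 1) / 3 \<le> 2^k * \<bar>t i - t j\<bar>" using D2 by simp
      then have "c * ((D + 1) / 3) \<le> c * (2^k * \<bar>t i - t j\<bar>)"
        using c by (intro mult_left_mono) auto
      then have "c * (D + 1) / 3 \<le> 2^k * (c * \<bar>t i - t j\<bar>)" by (simp only: ac_simps times_divide_eq_right)
      also have "\<dots> \<le> 2^k * (\<bar>a i - a j\<bar> + \<bar>b i - b j\<bar>)" using sep ij by (intro mult_left_mono) auto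
      finally have d: "c * (D + 1) / 3 / 2^k \<le> \<bar>a i - a j\<bar> + \<bar>b i - b j\<bar>"
        by (simp add: field_simps)
      have "real (card (T i j)) \<le> 1 + 8 * (1 + 2 * B) / (c * (D + 1) / 3 / 2^k)"
        unfolding T_def by (rule card_common_cells) (use B ij d c D2 in auto)
      moreover have "8 * (1 + 2 * B) / (c * (D + 1) / 3 / 2^k) = (24 * (1 + 2 * B) / c) * 2^k * (1 / (D + 1))"
        by simp
      moreover have "1 \<le> 2 * 2^k * (1 / (D + 1))" using D D2
        unfolding D_def[symmetric] by (simp add: field_simps)
      ultimately show ?thesis unfolding K D_def[symmetric] distrib_right by linarith
    qed
  qed
  have "{(p, p'). p \<in> I \<and> p' \<in> I \<and> f p = f p'} \<subseteq>
        (\<lambda>((i, j), m). ((i, m), (j, m))) ` Sigma (J \<times> J) (\<lambda>(i, j). T i j)"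
  proof safe
    fix i m j m'
    assume A: "(i, m) \<in> I" "(j, m') \<in> I" "f (i, m) = f (j, m')"
    then have mem: "i \<in> J" "j \<in> J" "m \<in> S i" "m' \<in> S j" unfolding I_def by auto
    have "\<lfloor>2^k * x i m\<rfloor> = \<lfloor>2^k * x j m'\<rfloor>"
      and eq: "\<lfloor>2^k * (a i * x i m + b i)\<rfloor> = \<lfloor>2^k * (a j * x j m' + b j)\<rfloor>"
      using A(3) unfolding f_def dyadic_cell_def by auto
    then have "m = m'" using x(1) mem by simp
    then have "m \<in> T i j" unfolding T_def using S mem x(1) eq by blast
    then show "((i, m), (j, m')) \<in> (\<lambda>((i, j), m). ((i, m), (j, m))) ` Sigma (J \<times> J) (\<lambda>(i, j). T i j)"
      using mem \<open>m = m'\<close> by (intro image_eqI[where x = "((i, j), m)"]) auto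
  qed
  then have "card {(p, p'). p \<in> I \<and> p' \<in> I \<and> f p = f p'} \<le> card (Sigma (J \<times> J) (\<lambda>(i, j). T i j))"
    using finJ finT by (intro surj_card_le) auto
  also have "\<dots> = (\<Sum>i\<in>J. \<Sum>j\<in>J. card (T i j))"
    using finJ finT by (simp add: sum.cartesian_product case_prod_unfold)
  finally have "real (card {(p, p'). p \<in> I \<and> p' \<in> I \<and> f p = f p'}) \<le> (\<Sum>i\<in>J. \<Sum>j\<in>J. real (card (T i j)))"
    by (simp only: of_nat_le_iff flip: of_nat_sum)
  also have "\<dots> \<le> (\<Sum>i\<in>J. \<Sum>j\<in>J. K * 2^k * (1 / (\<bar>real_of_int (i - j)\<bar> + 1)))"
    by (intro sum_mono T)
  also have "\<dots> \<le> (\<Sum>i\<in>J. K * 2^k * (2 * (real k + 1)))"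
  proof (intro sum_mono)
    fix i assume "i \<in> J"
    then have "(\<Sum>j\<in>J. 1 / (\<bar>real_of_int (i - j)\<bar> + 1)) \<le> 2 * (real k + 1)"
      using J by (intro sum_inverse_distance_le) auto
    then show "(\<Sum>j\<in>J. K * 2^k * (1 / (\<bar>real_of_int (i - j)\<bar> + 1))) \<le> K * 2^k * (2 * (real k + 1))"
      unfolding sum_distrib_left[symmetric] using K0 by (intro mult_left_mono) auto
  qed
  also have "\<dots> = N * (K * 2^k * (2 * (real k + 1)))" unfolding N_def by simp
  finally have coll: "real (card {(p, p'). p \<in> I \<and> p' \<in> I \<and> f p = f p'}) \<le> N * (K * 2^k * (2 * (real k + 1)))" .
  have "(N * (w * 2^k))\<^sup>2 \<le> (real (card I))\<^sup>2" using I N w by (intro power_mono) auto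
  also have "\<dots> \<le> real (card Q) * real (card {(p, p'). p \<in> I \<and> p' \<in> I \<and> f p = f p'})"
    using finI G fQ unfolding Q_def by (intro card_squared_le_collisions) auto
  also have "\<dots> \<le> real (card Q) * (N * (K * 2^k * (2 * (real k + 1))))"
    by (intro mult_left_mono coll) auto
  finally have "(N * 2^k) * (N * w\<^sup>2 * 2^k) \<le> (N * 2^k) * (2 * K * (real k + 1) * real (card Q))"
    by (simp add: power2_eq_square algebra_simps)
  then show ?thesis using N unfolding N_def[symmetric] Q_def[symmetric] by simp
qed

section \<open>Dyadic pigeonholing\<close>

text \<open>For a set \<open>A\<close> that need not be measurable, positive outer measure is expressed by a lower bound for the
  measure of all measurable supersets.\<close>

lemma outer_measure_pos_if_not_negligible:
  fixes A :: "real set"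
  assumes "\<not> negligible A"
  obtains \<mu> where "0 < \<mu>" "\<And>B. \<lbrakk>B \<in> sets lebesgue; A \<subseteq> B\<rbrakk> \<Longrightarrow> ennreal \<mu> \<le> emeasure lebesgue B"
proof (rule ccontr)
  assume neg: "\<not> thesis"
  have "negligible A"
    unfolding negligible_outer
  proof (intro allI impI)
    fix e :: real
    assume "e > 0"
    with neg that obtain B where B: "B \<in> sets lebesgue" "A \<subseteq> B" "emeasure lebesgue B < ennreal e"
      by (meson not_le)
    then have "B \<in> lmeasurable" by (metis fmeasurableI ennreal_less_top less_trans infinity_ennreal_def)
    moreover have "measure lebesgue B < e"
      using B \<open>e > 0\<close> \<open>B \<in> lmeasurable\<close> by (simp add: emeasure_eq_measure2 ennreal_less_iff)
    ultimately show "\<exists>T. A \<subseteq> T \<and> T \<in> lmeasurable \<and> measure lebesgue T < e" using B by blast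
  qed
  with assms show False by simp
qed

lemma emeasure_dyadic_intervals_le:
  fixes J :: "int set"
  assumes "finite J"
  shows "emeasure lebesgue (\<Union>j\<in>J. {real_of_int j / 2^k..<(real_of_int j + 1) / 2^k}) \<le> ennreal (real (card J) / 2^k)"
proof -
  have "emeasure lebesgue (\<Union>j\<in>J. {real_of_int j / 2^k..<(real_of_int j + 1) / 2^k})
     \<le> (\<Sum>j\<in>J. emeasure lebesgue {real_of_int j / 2^k..<(real_of_int j + 1) / 2^k})"
    using assms by (intro emeasure_subadditive_finite) auto
  also have "\<dots> = (\<Sum>j\<in>J. ennreal (1 / 2^k))"
    by (intro sum.cong refl) (simp add: divide_right_mono add_divide_distrib)
  also have "\<dots> = ennreal (real (card J) / 2^k)"
    by (subst sum_ennreal) auto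
  finally show ?thesis .
qed

text \<open>If at every scale the intervals of length \<open>2\<^sup>-\<^sup>k\<close> that meet \<open>{t \<in> A. P k t}\<close> were fewer than claimed,
  then their union over all scales, which covers \<open>A\<close>, would have measure at most
  \<open>\<Sum>k. \<mu> (1 - r) r\<^sup>k / 2 = \<mu> / 2\<close>. Geometric weights lose a factor \<open>r\<^sup>k\<close>, which is a small power of the
  scale when \<open>r\<close> is close to 1. Counting intervals instead of measuring \<open>{t \<in> A. P k t}\<close> makes
  measurability irrelevant.\<close>

lemma dyadic_pigeonhole:
  fixes A :: "real set"
  assumes A: "A \<subseteq> {0..<1}" and \<mu>: "0 < \<mu>"
    and outer: "\<And>B. \<lbrakk>B \<in> sets lebesgue; A \<subseteq> B\<rbrakk> \<Longrightarrow> ennreal \<mu> \<le> emeasure lebesgue B"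
    and P: "\<And>t. t \<in> A \<Longrightarrow> \<exists>k. P k t"
    and r: "0 < r" "r < 1"
  shows "\<exists>k. \<mu> * ((1 - r) / 2 * r^k) * 2^k \<le> real (card ((\<lambda>t. \<lfloor>2^k * t\<rfloor>) ` {t \<in> A. P k t}))"
proof (rule ccontr)
  define J where "J k = (\<lambda>t. \<lfloor>2^k * t\<rfloor>) ` {t \<in> A. P k t}" for k
  define C where "C k = (\<Union>j\<in>J k. {real_of_int j / 2^k..<(real_of_int j + 1) / 2^k})" for k
  assume "\<not> ?thesis"
  then have small: "real (card (J k)) < \<mu> * ((1 - r) / 2 * r^k) * 2^k" for k
    unfolding J_def by (meson not_le)
  have "J k \<subseteq> {0..<2^k}" for k unfolding J_def using A by (auto intro!: dyadic_index)
  then have fin: "finite (J k)" for k using finite_subset by blast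
  have meas: "C k \<in> sets lebesgue" for k unfolding C_def using fin by (intro sets.finite_UN) auto
  have "A \<subseteq> (\<Union>k. C k)"
  proof
    fix t assume t: "t \<in> A"
    then obtain k where "P k t" using P by blast
    then have "\<lfloor>2^k * t\<rfloor> \<in> J k" using t unfolding J_def by auto
    moreover have "t \<in> {real_of_int \<lfloor>2^k * t\<rfloor> / 2^k..<(real_of_int \<lfloor>2^k * t\<rfloor> + 1) / 2^k}"
      by (simp add: divide_le_eq less_divide_eq mult.commute)
    ultimately show "t \<in> (\<Union>k. C k)" unfolding C_def by blast
  qed
  then have "ennreal \<mu> \<le> emeasure lebesgue (\<Union>k. C k)" using meas by (intro outer) auto
  also have "\<dots> \<le> (\<Sum>k. emeasure lebesgue (C k))" using meas by (intro emeasure_subadditive_countably) auto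
  also have "\<dots> \<le> (\<Sum>k. ennreal (\<mu> * (1 - r) / 2 * r^k))"
  proof (intro suminf_le)
    fix k
    have "emeasure lebesgue (C k) \<le> ennreal (real (card (J k)) / 2^k)"
      unfolding C_def by (intro emeasure_dyadic_intervals_le fin)
    also have "\<dots> \<le> ennreal (\<mu> * (1 - r) / 2 * r^k)"
      using small[of k] by (intro ennreal_leI) (simp add: divide_le_eq)
    finally show "emeasure lebesgue (C k) \<le> ennreal (\<mu> * (1 - r) / 2 * r^k)" .
  qed auto
  also have "\<dots> = ennreal (\<mu> / 2)"
  proof (rule suminf_ennreal_eq)
    have "(\<lambda>k. \<mu> * (1 - r) / 2 * r^k) sums (\<mu> * (1 - r) / 2 * (1 / (1 - r)))"
      using r by (intro sums_mult geometric_sums) auto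
    moreover have "\<mu> * q / 2 * (1 / q) = \<mu> / 2" if "q \<noteq> 0" for q using that by simp
    from this[of "1 - r"] have "\<mu> * (1 - r) / 2 * (1 / (1 - r)) = \<mu> / 2" using r by linarith
    ultimately show "(\<lambda>k. \<mu> * (1 - r) / 2 * r^k) sums (\<mu> / 2)" by (simp only:)
  qed (use \<mu> r in simp)
  finally show False using \<mu> by (simp add: ennreal_le_iff)
qed

text \<open>Up to a constant, covering sets of diameter \<open>2\<^sup>-\<^sup>k\<close> may be replaced by dyadic squares of that side.\<close>

lemma dyadic_cells_of_small_set:
  assumes small: "\<And>p q. \<lbrakk>p \<in> U; q \<in> U\<rbrakk> \<Longrightarrow> dist p q \<le> (1/2)^k"
  shows "finite (dyadic_cell k ` U)" and "card (dyadic_cell k ` U) \<le> 9"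
proof -
  have "\<exists>u v. dyadic_cell k ` U \<subseteq> {u-1..u+1} \<times> {v-1..v+1}"
  proof (cases "U = {}")
    case False
    then obtain q where q: "q \<in> U" by blast
    have *: "\<lfloor>2^k * y\<rfloor> \<in> {\<lfloor>2^k * x\<rfloor> - 1..\<lfloor>2^k * x\<rfloor> + 1}" if "\<bar>y - x\<bar> \<le> (1/2)^k" for x y :: real
    proof -
      have "\<bar>2^k * y - 2^k * x\<bar> = 2^k * \<bar>y - x\<bar>" by (simp add: abs_mult flip: right_diff_distrib)
      also have "\<dots> \<le> 2^k * (1/2)^k" using that by (intro mult_left_mono) auto
      also have "\<dots> = 1" by (simp flip: power_mult_distrib)
      finally have "\<bar>2^k * y - 2^k * x\<bar> \<le> 1" .
      then show ?thesis unfolding atLeastAtMost_iff by linarith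
    qed
    have "\<bar>fst p - fst q\<bar> \<le> (1/2)^k" "\<bar>snd p - snd q\<bar> \<le> (1/2)^k" if "p \<in> U" for p
      using small[OF that q] dist_fst_le[of p q] dist_snd_le[of p q] by (auto simp: dist_real_def)
    then have "dyadic_cell k ` U \<subseteq> {\<lfloor>2^k * fst q\<rfloor> - 1..\<lfloor>2^k * fst q\<rfloor> + 1} \<times> {\<lfloor>2^k * snd q\<rfloor> - 1..\<lfloor>2^k * snd q\<rfloor> + 1}"
      unfolding dyadic_cell_def using * by blast
    then show ?thesis by blast
  qed auto
  then obtain u v where uv: "dyadic_cell k ` U \<subseteq> {u-1..u+1} \<times> {v-1..v+1}" by blast
  then show "finite (dyadic_cell k ` U)" by (rule finite_subset) auto
  have "card (dyadic_cell k ` U) \<le> card ({u-1..u+1} \<times> {v-1..v+1})" using uv by (intro card_mono) auto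
  then show "card (dyadic_cell k ` U) \<le> 9" by (simp add: card_cartesian_product)
qed

text \<open>Absorbs the harmonic factor \<open>k + 1\<close> of \<open>kakeya_counting\<close> into one more power of \<open>r\<^sup>k\<close>.\<close>

lemma linear_times_geometric_le:
  fixes r :: real
  assumes "0 < r" "r < 1"
  shows "(real k + 1) * r^k * (1 - r) \<le> 1"
proof -
  have "(real k + 1) * r^k = (\<Sum>i<Suc k. r^k)" by simp
  also have "\<dots> \<le> (\<Sum>i<Suc k. r^i)" using assms by (intro sum_mono power_decreasing) auto
  finally have "(real k + 1) * r^k * (1 - r) \<le> (\<Sum>i<Suc k. r^i) * (1 - r)"
    using assms by (intro mult_right_mono) auto
  also have "\<dots> = 1 - r^Suc k" using one_diff_power_eq[of r "Suc k"] by (simp add: mult.commute)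
  also have "\<dots> \<le> 1" using assms by simp
  finally show ?thesis .
qed

text \<open>A lower bound, depending only on the family of lines and on \<open>r\<close>, for \<open>\<Sum>i. 2\<^bsup>-s \<kappa> i\<^esup>\<close> over all covers by
  sets \<open>U i\<close> of diameter at most \<open>2\<^bsup>-\<kappa> i\<^esup>\<close>. The parameter \<open>r\<close> stands for \<open>s\<close>: with \<open>r\<^sup>4 = 2\<^bsup>s - 2\<^esup>\<close> one has
  \<open>1 / (4 r\<^sup>4) = 2\<^bsup>-s\<^esup>\<close>. The fourth power is what the argument consumes: pigeonholing in the columns gives
  a factor \<open>r\<^sup>k\<close> that the Cauchy-Schwarz inequality squares, pigeonholing in the index set gives a
  third, and the harmonic sum a fourth.\<close>

lemma kakeya_content_bound:
  fixes A :: "real set" and a b :: "real \<Rightarrow> real" and U :: "nat \<Rightarrow> (real \<times> real) set" and \<kappa> :: "nat \<Rightarrow> nat"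
  assumes A: "A \<subseteq> {0..<1}" and \<mu>: "0 < \<mu>"
    and outer: "\<And>B. \<lbrakk>B \<in> sets lebesgue; A \<subseteq> B\<rbrakk> \<Longrightarrow> ennreal \<mu> \<le> emeasure lebesgue B"
    and B: "0 \<le> B" "\<And>t. t \<in> A \<Longrightarrow> \<bar>a t\<bar> \<le> B"
    and c: "0 < c" and sep: "\<And>t u. \<lbrakk>t \<in> A; u \<in> A\<rbrakk> \<Longrightarrow> c * \<bar>t - u\<bar> \<le> \<bar>a t - a u\<bar> + \<bar>b t - b u\<bar>"
    and r: "0 < r" "r < 1"
    and cover: "\<And>t x. \<lbrakk>t \<in> A; x \<in> {0..<1}\<rbrakk> \<Longrightarrow> (x, a t * x + b t) \<in> (\<Union>i. U i)"
    and small: "\<And>i p q. \<lbrakk>p \<in> U i; q \<in> U i\<rbrakk> \<Longrightarrow> dist p q \<le> (1/2)^\<kappa> i"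
    and sums: "\<And>F. finite F \<Longrightarrow> (\<Sum>i\<in>F. (1 / (4 * r^4))^\<kappa> i) \<le> e"
    and K: "K = 2 + 24 * (1 + 2 * B) / c"
  shows "\<mu> * (1 - r)^4 \<le> 144 * K * e"
proof -
  define G where "G k = (\<Union>i\<in>{i. \<kappa> i = k}. U i)" for k
  define w where "w k = (1 - r) / 2 * r^k" for k
  have w0: "0 \<le> w k" for k unfolding w_def using r by simp
  have K0: "K \<ge> 0" using B c K by simp
  \<comment> \<open>every line of the family has a scale at which it meets the cover in many columns\<close>
  have cols: "\<exists>k. w k * 2^k \<le> real (card (dyadic_columns k (G k) (a t) (b t)))" if t: "t \<in> A" for t
  proof -
    have "\<exists>k. 1 * ((1 - r) / 2 * r^k) * 2^k \<le>
       real (card ((\<lambda>x. \<lfloor>2^k * x\<rfloor>) ` {x \<in> {0..<1}. (x, a t * x + b t) \<in> G k}))"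
    proof (rule dyadic_pigeonhole)
      show "ennreal 1 \<le> emeasure lebesgue S" if S: "S \<in> sets lebesgue" "{0..<1} \<subseteq> S" for S :: "real set"
      proof -
        have "ennreal 1 = emeasure lebesgue {0..<1::real}" by simp
        also have "\<dots> \<le> emeasure lebesgue S" using S by (intro emeasure_mono) auto
        finally show ?thesis .
      qed
      show "\<exists>k. (x, a t * x + b t) \<in> G k" if "x \<in> {0..<1}" for x
        using cover[OF t that] unfolding G_def by auto
    qed (use r in auto)
    then show ?thesis unfolding dyadic_columns_def w_def by simp
  qed
  \<comment> \<open>one scale is good for many lines at once\<close>
  have "\<exists>k. \<mu> * ((1 - r) / 2 * r^k) * 2^k \<le> real (card ((\<lambda>t. \<lfloor>2^k * t\<rfloor>) `
      {t \<in> A. w k * 2^k \<le> real (card (dyadic_columns k (G k) (a t) (b t)))}))"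
    by (rule dyadic_pigeonhole[OF A \<mu> outer cols r])
  then obtain k where k: "\<mu> * w k * 2^k \<le> real (card ((\<lambda>t. \<lfloor>2^k * t\<rfloor>) `
      {t \<in> A. w k * 2^k \<le> real (card (dyadic_columns k (G k) (a t) (b t)))}))"
    unfolding w_def by blast
  define J where "J = (\<lambda>t. \<lfloor>2^k * t\<rfloor>) ` {t \<in> A. w k * 2^k \<le> real (card (dyadic_columns k (G k) (a t) (b t)))}"
  have "\<forall>j\<in>J. \<exists>t\<in>A. \<lfloor>2^k * t\<rfloor> = j \<and> w k * 2^k \<le> real (card (dyadic_columns k (G k) (a t) (b t)))"
    unfolding J_def by auto
  then obtain t where t: "\<And>j. j \<in> J \<Longrightarrow> t j \<in> A" "\<And>j. j \<in> J \<Longrightarrow> \<lfloor>2^k * t j\<rfloor> = j"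
    "\<And>j. j \<in> J \<Longrightarrow> w k * 2^k \<le> real (card (dyadic_columns k (G k) (a (t j)) (b (t j))))"
    by metis
  have JA: "J \<subseteq> {0..<2^k}" unfolding J_def using A by (auto intro!: dyadic_index)
  define M where "M = {i. \<kappa> i = k}"
  define \<rho> where "\<rho> = (1 / (4 * r^4))^k"
  have \<rho>: "\<rho> > 0" unfolding \<rho>_def using r by simp
  have M_le: "real (card F) * \<rho> \<le> e" if "finite F" "F \<subseteq> M" for F
  proof -
    have "real (card F) * \<rho> = (\<Sum>i\<in>F. (1 / (4 * r^4))^\<kappa> i)"
      unfolding \<rho>_def using that(2) by (subst sum.cong[OF refl, of F _ "\<lambda>_. (1 / (4 * r^4))^k"]) (auto simp: M_def)
    then show ?thesis using sums[OF that(1)] by simp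
  qed
  \<comment> \<open>only finitely many covering sets have a given scale, since each contributes \<open>\<rho>\<close> to the sum\<close>
  have finM: "finite M"
  proof -
    have "card F \<le> nat \<lceil>e / \<rho>\<rceil>" if "finite F" "F \<subseteq> M" for F
    proof -
      have "real (card F) \<le> e / \<rho>" using M_le[OF that] \<rho> by (simp add: le_divide_eq)
      then show ?thesis by linarith
    qed
    then show ?thesis by (intro conjunct1[OF finite_if_finite_subsets_card_bdd]) auto
  qed
  have Q: "dyadic_cell k ` G k = (\<Union>i\<in>M. dyadic_cell k ` U i)" unfolding G_def M_def by auto
  have U: "finite (dyadic_cell k ` U i)" "card (dyadic_cell k ` U i) \<le> 9" if "i \<in> M" for i
    using that small[of _ i] unfolding M_def by (auto intro!: dyadic_cells_of_small_set)
  have finQ: "finite (dyadic_cell k ` G k)" unfolding Q using finM U by auto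
  have "card (dyadic_cell k ` G k) \<le> (\<Sum>i\<in>M. card (dyadic_cell k ` U i))"
    unfolding Q by (rule card_UN_le[OF finM])
  also have "\<dots> \<le> (\<Sum>i\<in>M. 9)" by (intro sum_mono U)
  finally have "card (dyadic_cell k ` G k) \<le> 9 * card M" by simp
  then have cardQ: "real (card (dyadic_cell k ` G k)) \<le> 9 * real (card M)" by linarith
  have "(\<mu> * w k * 2^k) * ((w k)\<^sup>2 * 2^k) \<le> real (card J) * ((w k)\<^sup>2 * 2^k)"
    using k unfolding J_def[symmetric] by (intro mult_right_mono) auto
  also have "\<dots> = real (card J) * (w k)\<^sup>2 * 2^k" by simp
  also have "\<dots> \<le> 2 * K * (real k + 1) * real (card (dyadic_cell k ` G k))"
    by (rule kakeya_counting[OF JA t(2) B(1) _ c _ finQ w0 _ K]) (use t B sep in auto)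
  also have "\<dots> \<le> 2 * K * (real k + 1) * (9 * real (card M))"
    using cardQ K0 by (intro mult_left_mono) auto
  finally have "(\<mu> * w k * 2^k) * ((w k)\<^sup>2 * 2^k) * \<rho> \<le> 2 * K * (real k + 1) * (9 * real (card M)) * \<rho>"
    using \<rho> by (intro mult_right_mono) auto
  also have "\<dots> = 18 * K * (real k + 1) * (real (card M) * \<rho>)" by simp
  also have "\<dots> \<le> 18 * K * (real k + 1) * e"
    using M_le[OF finM] K0 by (intro mult_left_mono) auto
  finally have main: "(\<mu> * w k * 2^k) * ((w k)\<^sup>2 * 2^k) * \<rho> \<le> 18 * K * (real k + 1) * e" .
  have "e \<ge> 0" using sums[of "{}"] by simp
  have "(2::real)^k * 2^k = 4^k" by (simp flip: power_mult_distrib)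
  then have \<rho>1: "2^k * 2^k * \<rho> * (r^k)^4 = 1"
    unfolding \<rho>_def using r by (simp add: power_divide power_mult_distrib flip: power_mult) (simp add: mult.commute)
  have "\<mu> * ((1 - r)^3 / 8) = \<mu> * ((1 - r)^3 / 8) * (2^k * 2^k * \<rho> * (r^k)^4)"
    unfolding \<rho>1 by simp
  also have "\<dots> = (\<mu> * w k * 2^k) * ((w k)\<^sup>2 * 2^k) * \<rho> * r^k"
    unfolding w_def by (simp add: power2_eq_square power3_eq_cube power4_eq_xxxx)
  also have "\<dots> \<le> 18 * K * (real k + 1) * e * r^k" using main r by (intro mult_right_mono) auto
  finally have "\<mu> * ((1 - r)^3 / 8) * (8 * (1 - r)) \<le> 18 * K * (real k + 1) * e * r^k * (8 * (1 - r))"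
    using r by (intro mult_right_mono) auto
  also have "\<dots> = 144 * K * e * ((real k + 1) * r^k * (1 - r))" by simp
  also have "\<dots> \<le> 144 * K * e * 1"
    using K0 \<open>e \<ge> 0\<close> r by (intro mult_left_mono linear_times_geometric_le) auto
  finally have fin: "\<mu> * ((1 - r)^3 / 8) * (8 * (1 - r)) \<le> 144 * K * e * 1" .
  have "\<mu> * (q^3 / 8) * (8 * q) = \<mu> * q^4" for q
    by (simp add: power3_eq_cube power4_eq_xxxx)
  from fin[unfolded this] show ?thesis by simp
qed

section \<open>Hausdorff measure and its covers\<close>

text \<open>For \<open>d > 0\<close> the largest \<open>k\<close> with \<open>d \<le> 2\<^sup>-\<^sup>k\<close> works. The term \<open>\<eta>\<close> pays for \<open>d = 0\<close>, where no
  scale is comparable to \<open>d\<close> and any sufficiently fine one is taken.\<close>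

lemma dyadic_scale_exists:
  fixes d s \<eta> :: real
  assumes "0 \<le> d" "d \<le> 1" "0 < s" "0 < \<eta>"
  shows "\<exists>k. d \<le> (1/2)^k \<and> (2 powr - s)^k \<le> 2 powr s * (d powr s + \<eta>)"
proof (cases "d = 0")
  case True
  have "2 powr - s < 1" using assms by (simp add: powr_less_one)
  then obtain k where k: "(2 powr - s)^k < \<eta>" using real_arch_pow_inv assms by blast
  also have "\<dots> \<le> 2 powr s * \<eta>" using assms by (simp add: ge_one_powr_ge_zero)
  finally show ?thesis using True by (intro exI[of _ k]) auto
next
  case False
  then have "d > 0" using assms by simp
  then obtain m where "(1/2)^m < d" using real_arch_pow_inv[of d "1/2"] by auto
  define n where "n = (LEAST n. (1/2)^n < d)"
  have n: "(1/2)^n < d" unfolding n_def by (rule LeastI) fact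
  then have "n \<noteq> 0" using assms by (intro notI) simp
  then obtain k where k: "n = Suc k" by (cases n) auto
  have "\<not> (1/2)^k < d" using not_less_Least[of k "\<lambda>n. (1/2)^n < d"] k unfolding n_def by simp
  moreover have "(2 powr - s)^k = 2 powr s * ((1/2)^Suc k) powr s"
  proof -
    have "(1/2)^Suc k = 2 powr (- real (Suc k))"
      by (simp add: powr_minus powr_realpow power_divide inverse_eq_divide del: of_nat_Suc)
    then have "((1/2)^Suc k) powr s = 2 powr (- real (Suc k) * s)" by (simp add: powr_powr)
    then have "2 powr s * ((1/2)^Suc k) powr s = 2 powr (- s * real k)"
      by (simp add: algebra_simps flip: powr_add)
    also have "\<dots> = (2 powr - s)^k" by (simp add: powr_powr flip: powr_realpow)
    finally show ?thesis ..
  qed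
  moreover have "((1/2)^Suc k) powr s \<le> d powr s" using n k assms by (intro powr_mono2) auto
  then have "2 powr s * ((1/2)^Suc k) powr s \<le> 2 powr s * (d powr s + \<eta>)" using assms
    by (intro mult_left_mono) auto
  ultimately show ?thesis by (intro exI[of _ k]) auto
qed

text \<open>Replaces diameters by dyadic scales. A covering set may be a point, to whose diameter 0 no scale
  corresponds; an extra allowance of \<open>e1 / 2\<^bsup>i + 1\<^esup>\<close> for the \<open>i\<close>-th set makes room for one. Passing from \<open>s\<close>
  to a larger \<open>s'\<close> is harmless for sets of diameter at most 1; it serves to avoid the exponent 0.\<close>

lemma dyadic_cover_of_hausdorff_null:
  fixes E :: "'a::metric_space set"
  assumes null: "hausdorff_measure s E = 0" and s: "0 \<le> s" "s \<le> s'" "0 < s'" and e: "0 < e"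
  obtains U :: "nat \<Rightarrow> 'a set" and \<kappa> :: "nat \<Rightarrow> nat" where "E \<subseteq> (\<Union>i. U i)"
    "\<And>i p q. \<lbrakk>p \<in> U i; q \<in> U i\<rbrakk> \<Longrightarrow> dist p q \<le> (1/2)^\<kappa> i"
    "\<And>F. finite F \<Longrightarrow> (\<Sum>i\<in>F. (2 powr - s')^\<kappa> i) \<le> e"
proof -
  define e1 where "e1 = e / (2 * 2 powr s')"
  have e1: "e1 > 0" unfolding e1_def using e by simp
  have "hausdorff_premeasure s 1 E \<le> hausdorff_measure s E"
    unfolding hausdorff_measure_def by (intro SUP_upper) simp
  then have "hausdorff_premeasure s 1 E < ennreal e1" using null e1 by simp
  then obtain U :: "nat \<Rightarrow> 'a set" where U: "E \<subseteq> (\<Union>i. U i)"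
    "\<And>i. bounded (U i)" "\<And>i. diameter (U i) \<le> 1"
    and lt: "(\<Sum>i. diam_power s (U i)) < ennreal e1"
    unfolding hausdorff_premeasure_def INF_less_iff by blast
  define d where "d i = diameter (U i)" for i
  have d: "0 \<le> d i" "d i \<le> 1" for i
    unfolding d_def using U diameter_ge_0 by auto
  have D: "ennreal (d i powr s') \<le> diam_power s (U i)" for i
  proof -
    have "d i powr s' \<le> 1" using d[of i] s by (simp add: powr_le1)
    moreover have "d i powr s' \<le> d i powr s" if "s \<noteq> 0"
      using d[of i] s that by (cases "d i = 0") (auto intro: powr_mono')
    ultimately show ?thesis
      using s unfolding diam_power_def by (auto simp: d_def ennreal_leI)
  qed
  have sumD: "(\<Sum>i\<in>F. d i powr s') \<le> e1" if "finite F" for F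
  proof -
    have "ennreal (\<Sum>i\<in>F. d i powr s') = (\<Sum>i\<in>F. ennreal (d i powr s'))" by (simp add: sum_ennreal)
    also have "\<dots> \<le> (\<Sum>i\<in>F. diam_power s (U i))" by (intro sum_mono D)
    also have "\<dots> \<le> (\<Sum>i. diam_power s (U i))" by (intro sum_le_suminf that) auto
    also have "\<dots> \<le> ennreal e1" using lt by simp
    finally show ?thesis using e1 by (simp add: ennreal_le_iff)
  qed
  have sumH: "(\<Sum>i\<in>F. e1 * (1/2)^Suc i) \<le> e1" if "finite F" for F
  proof -
    have *: "(\<lambda>i. e1 * (1/2)^Suc i) sums (e1 * 1)" by (intro sums_mult power_half_series)
    then have "(\<Sum>i\<in>F. e1 * (1/2)^Suc i) \<le> (\<Sum>i. e1 * (1/2)^Suc i)"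
      using e1 that by (intro sum_le_suminf) (auto simp: sums_iff)
    then show ?thesis using * by (simp add: sums_iff)
  qed
  have "\<exists>k. d i \<le> (1/2)^k \<and> (2 powr - s')^k \<le> 2 powr s' * (d i powr s' + e1 * (1/2)^Suc i)" for i
    using d e1 s by (intro dyadic_scale_exists) auto
  then obtain \<kappa> where \<kappa>: "\<And>i. d i \<le> (1/2)^\<kappa> i"
     "\<And>i. (2 powr - s')^\<kappa> i \<le> 2 powr s' * (d i powr s' + e1 * (1/2)^Suc i)"
    by metis
  show ?thesis
  proof (rule that[OF U(1)])
    show "dist p q \<le> (1/2)^\<kappa> i" if "p \<in> U i" "q \<in> U i" for i p q
      using diameter_bounded_bound[OF U(2) that] \<kappa>(1)[of i] unfolding d_def by simp
    show "(\<Sum>i\<in>F. (2 powr - s')^\<kappa> i) \<le> e" if F: "finite F" for F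
    proof -
      have "(\<Sum>i\<in>F. (2 powr - s')^\<kappa> i) \<le> (\<Sum>i\<in>F. 2 powr s' * (d i powr s' + e1 * (1/2)^Suc i))"
        by (intro sum_mono \<kappa>)
      also have "\<dots> = 2 powr s' * ((\<Sum>i\<in>F. d i powr s') + (\<Sum>i\<in>F. e1 * (1/2)^Suc i))"
        by (simp only: sum_distrib_left[symmetric] sum.distrib)
      also have "\<dots> \<le> 2 powr s' * (e1 + e1)" using sumD[OF F] sumH[OF F] by (intro mult_left_mono add_mono) auto
      also have "\<dots> = e" unfolding e1_def by simp
      finally show ?thesis .
    qed
  qed
qed

lemma hausdorff_measure_isometry_le:
  fixes f :: "'a::metric_space \<Rightarrow> 'b::metric_space"
  assumes f: "\<And>x y. dist (f x) (f y) = dist x y"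
  shows "hausdorff_measure s (f ` E) \<le> hausdorff_measure s E"
proof -
  have diam: "diameter (f ` U) = diameter U" for U
  proof -
    have "(\<lambda>(x, y). dist x y) ` (f ` U \<times> f ` U) = (\<lambda>(x, y). dist x y) ` (U \<times> U)"
      using f by (force simp: image_iff)
    then show ?thesis unfolding diameter_def by simp
  qed
  have bdd: "bounded (f ` U)" if "bounded U" for U
    using that f unfolding bounded_def by (metis (no_types, opaque_lifting) imageE)
  have "hausdorff_premeasure s \<delta> (f ` E) \<le> hausdorff_premeasure s \<delta> E" for \<delta>
    unfolding hausdorff_premeasure_def
  proof (rule INF_mono)
    fix U :: "nat \<Rightarrow> 'a set"
    assume U: "U \<in> {U. E \<subseteq> (\<Union>i. U i) \<and> (\<forall>i. bounded (U i) \<and> diameter (U i) \<le> \<delta>)}"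
    have "f ` E \<subseteq> (\<Union>i. f ` U i)" using U unfolding image_UN[symmetric] by (intro image_mono) simp
    then have "(\<lambda>i. f ` U i) \<in> {U. f ` E \<subseteq> (\<Union>i. U i) \<and> (\<forall>i. bounded (U i) \<and> diameter (U i) \<le> \<delta>)}"
      using U bdd by (simp add: diam)
    moreover have "(\<Sum>i. diam_power s (f ` U i)) = (\<Sum>i. diam_power s (U i))"
      unfolding diam_power_def diam image_is_empty ..
    ultimately show "\<exists>V\<in>{U. f ` E \<subseteq> (\<Union>i. U i) \<and> (\<forall>i. bounded (U i) \<and> diameter (U i) \<le> \<delta>)}.
        (\<Sum>i. diam_power s (V i)) \<le> (\<Sum>i. diam_power s (U i))"
      by (intro bexI) auto
  qed
  then show ?thesis unfolding hausdorff_measure_def by (intro SUP_mono) blast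
qed

text \<open>The grid of \<open>N\<^sup>2\<close> squares of side \<open>1 / N\<close>, listed row by row and followed by empty sets, because a cover
  must be indexed by all natural numbers.\<close>

lemma grid_cover_of_unit_square:
  fixes a b :: real
  assumes N: "N > 0" and s: "0 < s"
  obtains V :: "nat \<Rightarrow> (real \<times> real) set" where "{a..a+1} \<times> {b..b+1} \<subseteq> (\<Union>i. V i)"
    "\<And>i. bounded (V i)" "\<And>i. diameter (V i) \<le> 2 / real N"
    "(\<Sum>i. diam_power s (V i)) \<le> ennreal ((real N)\<^sup>2 * (2 / real N) powr s)"
proof -
  define W where "W p q = {a + real p / N..a + (real p + 1) / N} \<times> {b + real q / N..b + (real q + 1) / N}" for p q
  define V where "V i = (if i < N * N then W (i div N) (i mod N) else {})" for i
  have bdd: "bounded (V i)" for i unfolding V_def W_def by (auto intro: bounded_Times)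
  have Wd: "diameter (W p q) \<le> 2 / real N" for p q
  proof (rule diameter_le)
    fix x y assume "x \<in> W p q" "y \<in> W p q"
    then have "\<bar>fst x - fst y\<bar> \<le> 1 / N" "\<bar>snd x - snd y\<bar> \<le> 1 / N"
      unfolding W_def by (auto simp: add_divide_distrib)
    moreover have "norm (x - y) \<le> norm (fst (x - y)) + norm (snd (x - y))"
      by (metis norm_Pair_le prod.collapse)
    ultimately show "norm (x - y) \<le> 2 / real N" by simp
  qed simp
  have diam: "diameter (V i) \<le> 2 / real N" for i unfolding V_def using Wd by simp
  show ?thesis
  proof (rule that[OF _ bdd diam])
    show "{a..a+1} \<times> {b..b+1} \<subseteq> (\<Union>i. V i)"
    proof safe
      fix x y assume x: "x \<in> {a..a+1}" and y: "y \<in> {b..b+1}"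
      have *: "\<exists>p<N. u + real p / N \<le> z \<and> z \<le> u + (real p + 1) / N" if "z \<in> {u..u+1}" for u z :: real
      proof (cases "z = u + 1")
        case True
        then show ?thesis using N by (intro exI[of _ "N - 1"]) (auto simp: of_nat_diff field_simps)
      next
        case False
        define p where "p = nat \<lfloor>N * (z - u)\<rfloor>"
        have 1: "0 \<le> N * (z - u)" "N * (z - u) < N" using that False N by auto
        have "real p \<le> N * (z - u)" "N * (z - u) \<le> real p + 1" "p < N"
          unfolding p_def using 1 by linarith+
        then show ?thesis using N by (intro exI[of _ p]) (auto simp: field_simps)
      qed
      obtain p q where pq: "p < N" "q < N" "(x, y) \<in> W p q"
        using *[OF x] *[OF y] unfolding W_def by auto
      have "p * N + q < (p + 1) * N" using pq by simp
      also have "\<dots> \<le> N * N" using pq by (intro mult_right_mono) auto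
      finally have "p * N + q < N * N" .
      then have "(x, y) \<in> V (p * N + q)" using pq unfolding V_def by simp
      then show "(x, y) \<in> (\<Union>i. V i)" by blast
    qed
    have "(\<Sum>i. diam_power s (V i)) = (\<Sum>i<N*N. diam_power s (V i))"
      by (rule suminf_finite) (auto simp: V_def diam_power_def)
    also have "\<dots> \<le> (\<Sum>i<N*N. ennreal ((2 / real N) powr s))"
    proof (intro sum_mono)
      fix i
      have "diameter (V i) powr s \<le> (2 / real N) powr s"
        using s diam bdd by (intro powr_mono2) (auto intro: diameter_ge_0)
      then show "diam_power s (V i) \<le> ennreal ((2 / real N) powr s)"
        using s unfolding diam_power_def by (auto intro: ennreal_leI)
    qed
    also have "\<dots> = ennreal (\<Sum>i<N*N. (2 / real N) powr s)" by (rule sum_ennreal) simp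
    also have "\<dots> = ennreal ((real N)\<^sup>2 * (2 / real N) powr s)" by (simp add: power2_eq_square)
    finally show "(\<Sum>i. diam_power s (V i)) \<le> ennreal ((real N)\<^sup>2 * (2 / real N) powr s)" .
  qed
qed

text \<open>For \<open>s > 2\<close> the sum \<open>N\<^sup>2 (2 / N)\<^sup>s\<close> of a grid cover of a unit square tends to 0. The plane is a
  countable union of unit squares, and the \<open>n\<close>-th one is subdivided so finely that its sum is at
  most \<open>e / 2\<^bsup>n + 1\<^esup>\<close>.\<close>

lemma hausdorff_measure_plane_zero:
  fixes E :: "(real \<times> real) set"
  assumes s: "2 < s"
  shows "hausdorff_measure s E = 0"
proof -
  have "hausdorff_premeasure s \<delta> E \<le> ennreal e" if \<delta>: "\<delta> > 0" and e: "e > 0" for \<delta> e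
  proof -
    have lim: "((\<lambda>N. (real N)\<^sup>2 * (2 / real N) powr s) \<longlongrightarrow> 0) sequentially"
    proof -
      have "((\<lambda>N. 2 powr s * (real N) powr (2 - s)) \<longlongrightarrow> 2 powr s * 0) sequentially"
        using s by (intro tendsto_mult tendsto_const tendsto_neg_powr filterlim_real_sequentially) auto
      moreover have "\<forall>\<^sub>F N in sequentially. 2 powr s * (real N) powr (2 - s) = (real N)\<^sup>2 * (2 / real N) powr s"
        using eventually_gt_at_top[of 0]
        by eventually_elim (simp add: powr_divide powr_diff powr_numeral)
      ultimately show ?thesis by (simp add: tendsto_cong)
    qed
    have lim2: "((\<lambda>N. 2 / real N) \<longlongrightarrow> 0) sequentially" by (rule lim_const_over_n)
    have "\<exists>N>0. (real N)\<^sup>2 * (2 / real N) powr s < e * (1/2)^Suc n \<and> 2 / real N < \<delta>" for n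
    proof -
      have "\<forall>\<^sub>F N in sequentially. (real N)\<^sup>2 * (2 / real N) powr s < e * (1/2)^Suc n"
        using e by (intro order_tendstoD(2)[OF lim]) simp
      moreover have "\<forall>\<^sub>F N in sequentially. 2 / real N < \<delta>"
        using \<delta> by (intro order_tendstoD(2)[OF lim2])
      ultimately have "\<forall>\<^sub>F N in sequentially. N > 0 \<and> (real N)\<^sup>2 * (2 / real N) powr s < e * (1/2)^Suc n \<and> 2 / real N < \<delta>"
        using eventually_gt_at_top[of 0] by eventually_elim auto
      then show ?thesis using eventually_happens' sequentially_bot by blast
    qed
    then obtain N where N: "\<And>n. N n > 0" "\<And>n. (real (N n))\<^sup>2 * (2 / real (N n)) powr s < e * (1/2)^Suc n"
        "\<And>n. 2 / real (N n) < \<delta>" by metis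
    define sq where "sq n = (case from_nat n of (i, j) \<Rightarrow> {real_of_int i..real_of_int i + 1} \<times> {real_of_int j..real_of_int j + 1})" for n
    have "\<exists>V. sq n \<subseteq> (\<Union>i. V i) \<and> (\<forall>i. bounded (V i) \<and> diameter (V i) \<le> 2 / real (N n)) \<and>
       (\<Sum>i. diam_power s (V i)) \<le> ennreal ((real (N n))\<^sup>2 * (2 / real (N n)) powr s)" for n
    proof -
      obtain i j where ij: "from_nat n = (i :: int, j :: int)" by fastforce
      obtain V where "{real_of_int i..real_of_int i + 1} \<times> {real_of_int j..real_of_int j + 1} \<subseteq> (\<Union>i. V i)"
        "\<And>i. bounded (V i)" "\<And>i. diameter (V i) \<le> 2 / real (N n)"
        "(\<Sum>i. diam_power s (V i)) \<le> ennreal ((real (N n))\<^sup>2 * (2 / real (N n)) powr s)"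
        using grid_cover_of_unit_square[OF N(1)[of n], of s i j] s by auto
      then show ?thesis unfolding sq_def ij by auto
    qed
    then obtain V where V: "\<And>n. sq n \<subseteq> (\<Union>i. V n i)"
      "\<And>n i. bounded (V n i)" "\<And>n i. diameter (V n i) \<le> 2 / real (N n)"
      "\<And>n. (\<Sum>i. diam_power s (V n i)) \<le> ennreal ((real (N n))\<^sup>2 * (2 / real (N n)) powr s)" by metis
    define U where "U m = (case prod_decode m of (n, i) \<Rightarrow> V n i)" for m
    have Udec: "U (prod_encode (n, i)) = V n i" for n i unfolding U_def by simp
    have "E \<subseteq> (\<Union>m. U m)"
    proof safe
      fix x y :: real
      define n where "n = to_nat (\<lfloor>x\<rfloor>, \<lfloor>y\<rfloor>)"
      have "(x, y) \<in> sq n" unfolding sq_def n_def by auto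
      then obtain i where "(x, y) \<in> V n i" using V(1) by blast
      then show "(x, y) \<in> (\<Union>m. U m)" using Udec by blast
    qed
    moreover have "bounded (U m) \<and> diameter (U m) \<le> \<delta>" for m
    proof -
      have "diameter (V n i) \<le> \<delta>" for n i using V(3)[of n i] N(3)[of n] by linarith
      then show ?thesis unfolding U_def using V(2) by (auto split: prod.split)
    qed
    ultimately have "hausdorff_premeasure s \<delta> E \<le> (\<Sum>m. diam_power s (U m))"
      unfolding hausdorff_premeasure_def by (intro INF_lower) auto
    also have "(\<Sum>m. diam_power s (U m)) = (\<Sum>m. (\<lambda>(n, i). diam_power s (V n i)) (prod_decode m))"
      unfolding U_def by (simp add: case_prod_unfold)
    also have "\<dots> = (\<Sum>n. \<Sum>i. diam_power s (V n i))"
      by (rule suminf_ennreal_2dimen) simp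
    also have "\<dots> \<le> (\<Sum>n. ennreal (e * (1/2)^Suc n))"
      by (intro suminf_le order.trans[OF V(4)] ennreal_leI less_imp_le[OF N(2)]) auto
    also have "\<dots> = ennreal (e * 1)"
      using e by (intro suminf_ennreal_eq sums_mult power_half_series) auto
    finally show ?thesis by simp
  qed
  note le = this
  have "hausdorff_premeasure s \<delta> E \<le> 0" if "\<delta> > 0" for \<delta>
  proof (rule ennreal_le_epsilon)
    show "hausdorff_premeasure s \<delta> E \<le> 0 + ennreal e" if "e > 0" for e
      using le[OF \<open>\<delta> > 0\<close> that] by simp
  qed
  then have "hausdorff_measure s E \<le> 0" unfolding hausdorff_measure_def by (intro SUP_least) auto
  then show ?thesis by simp
qed

lemma hausdorff_dim_plane_le: "hausdorff_dim (E :: (real \<times> real) set) \<le> 2"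
proof (rule ennreal_le_epsilon)
  fix e :: real assume e: "0 < e"
  have "hausdorff_dim E \<le> ennreal (2 + e)"
    unfolding hausdorff_dim_def
  proof (rule Inf_lower)
    have "0 \<le> 2 + e" "hausdorff_measure (2 + e) E = 0"
      using e hausdorff_measure_plane_zero[of "2 + e" E] by auto
    then show "ennreal (2 + e) \<in> {ennreal s |s. 0 \<le> s \<and> hausdorff_measure s E = 0}" by blast
  qed
  also have "\<dots> = 2 + ennreal e" using e by (simp add: ennreal_plus)
  finally show "hausdorff_dim E \<le> 2 + ennreal e" .
qed

section \<open>Unions of one-parameter families of lines\<close>

lemma not_negligible_countable_piece:
  fixes S :: "'a::euclidean_space set" and P :: "'i::countable \<Rightarrow> 'a \<Rightarrow> bool"
  assumes "\<not> negligible S" "\<And>x. x \<in> S \<Longrightarrow> \<exists>i. P i x"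
  obtains i where "\<not> negligible {x \<in> S. P i x}"
proof (rule ccontr)
  assume "\<not> thesis"
  with that have "negligible {x \<in> S. P i x}" for i by blast
  then have "negligible (\<Union>(range (\<lambda>i. {x \<in> S. P i x})))"
    by (intro negligible_countable_Union) auto
  moreover have "S = \<Union>(range (\<lambda>i. {x \<in> S. P i x}))" using assms(2) by auto
  ultimately show False using assms(1) by simp
qed

text \<open>A one-parameter family of lines whose parametrisation by a non-null set is expanding, up to a
  constant, sweeps out a set of dimension at least 2. A countable decomposition reduces this to bounded
  slopes and parameters in a unit interval, which \<open>kakeya_content_bound\<close> covers.\<close>

lemma hausdorff_measure_union_of_lines_nonzero:
  fixes A :: "real set" and a b :: "real \<Rightarrow> real" and E :: "(real \<times> real) set"
  assumes A: "\<not> negligible A"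
    and c: "0 < c" and sep: "\<And>t u. \<lbrakk>t \<in> A; u \<in> A\<rbrakk> \<Longrightarrow> c * \<bar>t - u\<bar> \<le> \<bar>a t - a u\<bar> + \<bar>b t - b u\<bar>"
    and lines: "\<And>t x. t \<in> A \<Longrightarrow> (x, a t * x + b t) \<in> E"
    and s: "0 \<le> s" "s < 2"
  shows "hausdorff_measure s E \<noteq> 0"
proof
  assume null: "hausdorff_measure s E = 0"
  have "\<exists>i. case i of (n :: nat, m :: int) \<Rightarrow> \<bar>a t\<bar> \<le> real n \<and> \<lfloor>t\<rfloor> = m" for t
    using real_arch_simple[of "\<bar>a t\<bar>"] by auto
  then obtain i where i: "\<not> negligible {t \<in> A. case i of (n :: nat, m :: int) \<Rightarrow> \<bar>a t\<bar> \<le> real n \<and> \<lfloor>t\<rfloor> = m}"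
    using not_negligible_countable_piece[OF A, of "\<lambda>i t. case i of (n :: nat, m :: int) \<Rightarrow> \<bar>a t\<bar> \<le> real n \<and> \<lfloor>t\<rfloor> = m"]
    by blast
  obtain n m where nm: "i = (n, m)" by fastforce
  define A1 where "A1 = {t \<in> A. \<bar>a t\<bar> \<le> real n \<and> \<lfloor>t\<rfloor> = m}"
  have A1: "\<not> negligible A1" using i unfolding nm A1_def by simp
  define A2 where "A2 = (+) (- real_of_int m) ` A1"
  have "\<not> negligible A2" using A1 unfolding A2_def by (metis negligible_translation_rev)
  then obtain \<mu> where \<mu>: "0 < \<mu>" "\<And>B. \<lbrakk>B \<in> sets lebesgue; A2 \<subseteq> B\<rbrakk> \<Longrightarrow> ennreal \<mu> \<le> emeasure lebesgue B"
    by (rule outer_measure_pos_if_not_negligible) (rule that)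
  have A2: "t + m \<in> A" "\<bar>a (t + m)\<bar> \<le> real n" "t \<in> {0..<1}" if "t \<in> A2" for t
    using that unfolding A2_def A1_def by (auto simp: floor_less_iff) linarith+
  define s' where "s' = max s 1"
  have s': "s \<le> s'" "0 < s'" "s' < 2" unfolding s'_def using s by auto
  define r where "r = 2 powr ((s' - 2) / 4)"
  have r: "0 < r" "r < 1" unfolding r_def using s' by (auto simp: powr_less_one)
  have "r^4 = 2 powr (of_nat 4 * ((s' - 2) / 4))" unfolding r_def by (rule powr_power) simp
  also have "of_nat 4 * ((s' - 2) / 4) = s' - 2" by simp
  also have "2 powr (s' - 2) = 2 powr s' / 4" by (simp add: powr_diff)
  finally have rs: "1 / (4 * r^4) = 2 powr - s'" by (simp add: powr_minus inverse_eq_divide)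
  define K where "K = 2 + 24 * (1 + 2 * real n) / c"
  have K: "K > 0" unfolding K_def using c by (intro add_pos_nonneg) auto
  \<comment> \<open>half of what \<open>kakeya_content_bound\<close> permits\<close>
  define e where "e = \<mu> * (1 - r)^4 / (288 * K)"
  have e: "e > 0" unfolding e_def using \<mu> r K by simp
  obtain U :: "nat \<Rightarrow> (real \<times> real) set" and \<kappa> :: "nat \<Rightarrow> nat" where U: "E \<subseteq> (\<Union>i. U i)"
    "\<And>i p q. \<lbrakk>p \<in> U i; q \<in> U i\<rbrakk> \<Longrightarrow> dist p q \<le> (1/2)^\<kappa> i"
    "\<And>F. finite F \<Longrightarrow> (\<Sum>i\<in>F. (2 powr - s')^\<kappa> i) \<le> e"
    using dyadic_cover_of_hausdorff_null[OF null s(1) s'(1,2) e] by metis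
  have "\<mu> * (1 - r)^4 \<le> 144 * K * e"
  proof (rule kakeya_content_bound[where A = A2 and a = "\<lambda>t. a (t + m)" and U = U and \<kappa> = \<kappa>
        and b = "\<lambda>t. b (t + m)" and B = "real n" and c = c])
    show "A2 \<subseteq> {0..<1}" using A2 by blast
    show "c * \<bar>t - u\<bar> \<le> \<bar>a (t + m) - a (u + m)\<bar> + \<bar>b (t + m) - b (u + m)\<bar>"
      if "t \<in> A2" "u \<in> A2" for t u
      using sep[OF A2(1)[OF that(1)] A2(1)[OF that(2)]] by simp
    show "(x, a (t + m) * x + b (t + m)) \<in> (\<Union>i. U i)" if "t \<in> A2" for t x
      using lines[OF A2(1)[OF that], of x] U(1) by auto
    show "(\<Sum>i\<in>F. (1 / (4 * r^4))^\<kappa> i) \<le> e" if "finite F" for F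
      unfolding rs by (rule U(3)[OF that])
  qed (use \<mu> A2 c r U(2) in \<open>auto simp: K_def\<close>)
  also have "144 * K * e = \<mu> * (1 - r)^4 / 2" unfolding e_def using K by simp
  finally have "\<mu> * (1 - r)^4 \<le> 0" by simp
  moreover have "\<mu> * (1 - r)^4 > 0" using \<mu> r by simp
  ultimately show False by simp
qed

text \<open>Reflection in the diagonal turns vertical lines into graphs of constant functions.\<close>

lemma hausdorff_measure_vertical_lines_nonzero:
  fixes A :: "real set" and E :: "(real \<times> real) set"
  assumes A: "\<not> negligible A" and lines: "\<And>t y. t \<in> A \<Longrightarrow> (t, y) \<in> E" and s: "0 \<le> s" "s < 2"
  shows "hausdorff_measure s E \<noteq> 0"
proof -
  have "hausdorff_measure s (prod.swap ` E) \<noteq> 0"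
  proof (rule hausdorff_measure_union_of_lines_nonzero[OF A, of 1 "\<lambda>_. 0" "\<lambda>t. t"])
    show "(x, 0 * x + t) \<in> prod.swap ` E" if "t \<in> A" for t x
      using lines[OF that, of x] by force
  qed (use s in auto)
  moreover have "hausdorff_measure s (prod.swap ` E) \<le> hausdorff_measure s E"
    by (rule hausdorff_measure_isometry_le) (simp add: dist_prod_def add.commute)
  ultimately show ?thesis by auto
qed

lemma hausdorff_dim_plane_eq_2:
  fixes E :: "(real \<times> real) set"
  assumes "\<And>s. \<lbrakk>0 \<le> s; s < 2\<rbrakk> \<Longrightarrow> hausdorff_measure s E \<noteq> 0"
  shows "hausdorff_dim E = 2"
proof (rule antisym[OF hausdorff_dim_plane_le])
  show "2 \<le> hausdorff_dim E"
    unfolding hausdorff_dim_def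
  proof (rule Inf_greatest)
    fix u assume "u \<in> {ennreal s |s. 0 \<le> s \<and> hausdorff_measure s E = 0}"
    then obtain s where s: "u = ennreal s" "0 \<le> s" "hausdorff_measure s E = 0" by blast
    then have "2 \<le> s" using assms not_less by blast
    then have "ennreal 2 \<le> u" unfolding s(1) by (intro ennreal_leI)
    then show "2 \<le> u" by simp
  qed
qed

section \<open>Lines covering the graph of a differentiable function\<close>

text \<open>If \<open>a x\<close> differs from \<open>F' x\<close>, then near \<open>x\<close> the graph leaves the line of slope \<open>a x\<close> through \<open>(x, F x)\<close> at
  a linear rate. Both the rate and the size of the neighbourhood depend on \<open>x\<close>, but countably many pieces
  make them uniform. The index \<open>m\<close> in the decomposition keeps each piece shorter than the
  neighbourhood, so that the estimate holds for all pairs of points of the piece.\<close>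

lemma transversal_separated_piece:
  fixes F F' a :: "real \<Rightarrow> real"
  assumes S: "S \<subseteq> I" "\<not> negligible S"
    and deriv: "\<And>x. x \<in> S \<Longrightarrow> (F has_real_derivative F' x) (at x within I)"
    and trans: "\<And>x. x \<in> S \<Longrightarrow> a x \<noteq> F' x"
  obtains A c where "A \<subseteq> S" "\<not> negligible A" "0 < c"
    "\<And>x y. \<lbrakk>x \<in> A; y \<in> A\<rbrakk> \<Longrightarrow> c * \<bar>x - y\<bar> \<le> \<bar>F y - F x - a x * (y - x)\<bar>"
proof -
  define P where "P i x = (case i of (n :: nat, m :: int) \<Rightarrow> \<lfloor>x * real (Suc n)\<rfloor> = m \<and>
     (\<forall>y\<in>I. \<bar>y - x\<bar> < inverse (real (Suc n)) \<longrightarrow> inverse (real (Suc n)) * \<bar>y - x\<bar> \<le> \<bar>F y - F x - a x * (y - x)\<bar>))" for i x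
  have "\<exists>i. P i x" if x: "x \<in> S" for x
  proof -
    define e where "e = \<bar>a x - F' x\<bar> / 2"
    have e: "e > 0" unfolding e_def using trans[OF x] by simp
    have "(F has_derivative (*) (F' x)) (at x within I)"
      using deriv[OF x] by (simp add: has_field_derivative_def)
    then obtain d where d: "d > 0"
      "\<And>y. \<lbrakk>y \<in> I; \<bar>y - x\<bar> < d\<rbrakk> \<Longrightarrow> \<bar>F y - F x - F' x * (y - x)\<bar> \<le> e * \<bar>y - x\<bar>"
      using e unfolding has_derivative_within_alt real_norm_def by blast
    obtain n where n: "inverse (real (Suc n)) < min d e" using reals_Archimedean[of "min d e"] d e by auto
    have "inverse (real (Suc n)) * \<bar>y - x\<bar> \<le> \<bar>F y - F x - a x * (y - x)\<bar>"
      if y: "y \<in> I" "\<bar>y - x\<bar> < inverse (real (Suc n))" for y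
    proof -
      have "inverse (real (Suc n)) * \<bar>y - x\<bar> \<le> e * \<bar>y - x\<bar>" using n by (intro mult_right_mono) auto
      moreover have "\<bar>F y - F x - F' x * (y - x)\<bar> \<le> e * \<bar>y - x\<bar>" using d(2) y n by simp
      moreover have "\<bar>(a x - F' x) * (y - x)\<bar> = 2 * (e * \<bar>y - x\<bar>)" unfolding e_def abs_mult by simp
      moreover have "F y - F x - a x * (y - x) = (F y - F x - F' x * (y - x)) - (a x - F' x) * (y - x)"
        by (simp add: algebra_simps)
      ultimately show ?thesis by linarith
    qed
    then have "P (n, \<lfloor>x * real (Suc n)\<rfloor>) x" unfolding P_def by simp
    then show ?thesis by blast
  qed
  then obtain i where i: "\<not> negligible {x \<in> S. P i x}"
    using not_negligible_countable_piece[OF S(2), of P] by blast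
  obtain n m where nm: "i = (n, m)" by fastforce
  show ?thesis
  proof (rule that[of "{x \<in> S. P i x}" "inverse (real (Suc n))"])
    fix x y assume "x \<in> {x \<in> S. P i x}" "y \<in> {x \<in> S. P i x}"
    then have x: "x \<in> S" "P (n, m) x" and y: "y \<in> S" "P (n, m) y" unfolding nm by auto
    have "\<lfloor>x * real (Suc n)\<rfloor> = m" "\<lfloor>y * real (Suc n)\<rfloor> = m" using x y unfolding P_def by auto
    then have "\<bar>y * real (Suc n) - x * real (Suc n)\<bar> < 1" by linarith
    then have "\<bar>y - x\<bar> * real (Suc n) < 1" by (simp add: abs_mult flip: left_diff_distrib)
    then have "\<bar>y - x\<bar> < inverse (real (Suc n))" by (simp add: inverse_eq_divide less_divide_eq)
    moreover have "y \<in> I" using y S by blast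
    ultimately show "inverse (real (Suc n)) * \<bar>x - y\<bar> \<le> \<bar>F y - F x - a x * (y - x)\<bar>"
      using x(2) unfolding P_def by (simp add: abs_minus_commute[of x y])
  qed (use i in auto)
qed

text \<open>A minimum of \<open>F - c x\<close> on \<open>[p, q]\<close> cannot be at an end point, because the one-sided derivatives there
  point downwards into the interval.\<close>

lemma derivative_darboux:
  fixes F F' :: "real \<Rightarrow> real"
  assumes "p < q" and deriv: "\<And>x. x \<in> {p..q} \<Longrightarrow> (F has_real_derivative F' x) (at x within {p..q})"
    and c: "F' p < c" "c < F' q"
  shows "\<exists>z\<in>{p<..<q}. F' z = c"
proof -
  define G where "G x = F x - c * x" for x
  have G: "(G has_real_derivative F' x - c) (at x within {p..q})" if "x \<in> {p..q}" for x
    unfolding G_def using deriv[OF that] by (auto intro!: derivative_eq_intros)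
  then have "continuous_on {p..q} G" by (rule DERIV_continuous_on)
  then obtain z where z: "z \<in> {p..q}" "\<And>y. y \<in> {p..q} \<Longrightarrow> G z \<le> G y"
    using continuous_attains_inf[of "{p..q}" G] \<open>p < q\<close> by auto
  have "z \<noteq> p"
  proof
    assume "z = p"
    obtain d where d: "d > 0" "\<And>h. \<lbrakk>h > 0; p + h \<in> {p..q}; h < d\<rbrakk> \<Longrightarrow> G p > G (p + h)"
      using has_real_derivative_neg_dec_right[OF G[of p]] c \<open>p < q\<close> by auto
    have "G p > G (p + min (d/2) (q - p))" using d(1) \<open>p < q\<close> by (intro d(2)) auto
    moreover have "G z \<le> G (p + min (d/2) (q - p))" using d(1) \<open>p < q\<close> by (intro z(2)) auto
    ultimately show False using \<open>z = p\<close> by simp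
  qed
  moreover have "z \<noteq> q"
  proof
    assume "z = q"
    obtain d where d: "d > 0" "\<And>h. \<lbrakk>h > 0; q - h \<in> {p..q}; h < d\<rbrakk> \<Longrightarrow> G q > G (q - h)"
      using has_real_derivative_pos_inc_left[OF G[of q]] c \<open>p < q\<close> by auto
    have "G q > G (q - min (d/2) (q - p))" using d(1) \<open>p < q\<close> by (intro d(2)) auto
    moreover have "G z \<le> G (q - min (d/2) (q - p))" using d(1) \<open>p < q\<close> by (intro z(2)) auto
    ultimately show False using \<open>z = q\<close> by simp
  qed
  ultimately have pzq: "p < z" "z < q" using z(1) by auto
  have "F' z - c = 0"
  proof (rule DERIV_local_min)
    show "(G has_real_derivative F' z - c) (at z)" using G[OF z(1)] pzq by (simp add: at_within_Icc_at)
    show "0 < min (z - p) (q - z)" using pzq by simp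
    show "\<forall>y. \<bar>z - y\<bar> < min (z - p) (q - z) \<longrightarrow> G z \<le> G y"
    proof (intro allI impI z(2))
      fix y assume "\<bar>z - y\<bar> < min (z - p) (q - z)"
      then show "y \<in> {p..q}" unfolding min_less_iff_conj atLeastAtMost_iff by linarith
    qed
  qed
  then show ?thesis using pzq by auto
qed

text \<open>If \<open>F'\<close> were constant, \<open>F\<close> would be affine; otherwise \<open>F'\<close> takes all values between two distinct ones.\<close>

lemma not_negligible_derivative_image:
  fixes F F' :: "real \<Rightarrow> real"
  assumes nonlinear: "\<not> (\<exists>a b. \<forall>x\<in>{0..1}. F x = a * x + b)"
    and deriv: "\<And>x. x \<in> {0..1} \<Longrightarrow> (F has_real_derivative F' x) (at x within {0..1})"
  shows "\<not> negligible (F' ` {0..1})"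
proof -
  have "\<exists>p q. 0 \<le> p \<and> p < q \<and> q \<le> 1 \<and> F' p \<noteq> F' q"
  proof (rule ccontr)
    assume neg: "\<not> ?thesis"
    have const: "F' x = F' 0" if "x \<in> {0..1}" for x
      using neg that by (cases "x = 0") auto
    have "((\<lambda>x. F x - F' 0 * x) has_real_derivative 0) (at x within {0..1})" if "x \<in> {0..1}" for x
      using deriv[OF that] const[OF that] by (auto intro!: derivative_eq_intros)
    then have "\<exists>b. \<forall>x\<in>{0..1}. F x - F' 0 * x = b"
      by (intro has_field_derivative_zero_constant) auto
    then obtain b where "\<forall>x\<in>{0..1}. F x = F' 0 * x + b" by (auto simp: algebra_simps)
    with nonlinear show False by blast
  qed
  then obtain p q where pq: "0 \<le> p" "p < q" "q \<le> 1" "F' p \<noteq> F' q" by blast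
  have d: "(F has_real_derivative F' x) (at x within {p..q})" if "x \<in> {p..q}" for x
    by (rule DERIV_subset[OF deriv]) (use that pq in auto)
  have d': "((\<lambda>x. - F x) has_real_derivative - F' x) (at x within {p..q})" if "x \<in> {p..q}" for x
    using d[OF that] by (rule DERIV_minus)
  have "\<exists>u v. u < v \<and> {u<..<v} \<subseteq> F' ` {0..1}"
  proof (cases "F' p < F' q")
    case True
    have "{F' p<..<F' q} \<subseteq> F' ` {0..1}"
    proof
      fix c assume "c \<in> {F' p<..<F' q}"
      then obtain z where "z \<in> {p<..<q}" "F' z = c" using derivative_darboux[OF pq(2) d, of c] by auto
      then show "c \<in> F' ` {0..1}" using pq by auto
    qed
    with True show ?thesis by blast
  next
    case False
    have "{F' q<..<F' p} \<subseteq> F' ` {0..1}"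
    proof
      fix c assume "c \<in> {F' q<..<F' p}"
      then obtain z where "z \<in> {p<..<q}" "F' z = c" using derivative_darboux[OF pq(2) d', of "- c"] by auto
      then show "c \<in> F' ` {0..1}" using pq by auto
    qed
    with False pq(4) show ?thesis by (meson not_less_iff_gr_or_eq)
  qed
  then obtain u v where "u < v" "{u<..<v} \<subseteq> F' ` {0..1}" by blast
  moreover have "\<not> negligible {u<..<v}" using \<open>u < v\<close> by (intro open_not_negligible) auto
  ultimately show ?thesis using negligible_subset by blast
qed

lemma line_through_point:
  fixes L :: "(real \<times> real) set"
  assumes L: "is_line L" "(u, v) \<in> L"
  shows "(\<forall>y. (u, y) \<in> L) \<or> (\<exists>a. \<forall>x. (x, a * (x - u) + v) \<in> L)"
proof -
  have aff: "affine L" and dim: "aff_dim L = 1" using L(1) unfolding is_line_def by auto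
  have "L \<noteq> {(u, v)}" using dim by auto
  then obtain u' v' where p: "(u', v') \<in> L" "(u', v') \<noteq> (u, v)" using L(2) by auto
  have *: "((1 - t) * u + t * u', (1 - t) * v + t * v') \<in> L" for t
    using mem_affine[OF aff L(2) p(1), of "1 - t" t] by simp
  show ?thesis
  proof (cases "u' = u")
    case True
    then have v: "v' - v \<noteq> 0" using p by simp
    have "(u, y) \<in> L" for y
    proof -
      define t where "t = (y - v) / (v' - v)"
      have "t * (v' - v) = y - v" unfolding t_def using v by simp
      then have "(1 - t) * v + t * v' = y" by (simp add: algebra_simps)
      moreover have "(1 - t) * u + t * u' = u" using True by (simp add: algebra_simps)
      ultimately show ?thesis using *[of t] by simp
    qed
    then show ?thesis by blast
  next
    case False
    then have u: "u' - u \<noteq> 0" by simp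
    have "(x, (v' - v) / (u' - u) * (x - u) + v) \<in> L" for x
    proof -
      define t where "t = (x - u) / (u' - u)"
      have "t * (u' - u) = x - u" unfolding t_def using u by simp
      then have 1: "(1 - t) * u + t * u' = x" by (simp add: algebra_simps)
      have "(v' - v) / (u' - u) * (x - u) = t * (v' - v)" unfolding t_def by simp
      then have "(1 - t) * v + t * v' = (v' - v) / (u' - u) * (x - u) + v" by (simp add: algebra_simps)
      then show ?thesis using *[of t] 1 by simp
    qed
    then show ?thesis by blast
  qed
qed

theorem corollary2p7:
  fixes F F' :: "real \<Rightarrow> real"
    and X :: "(real \<times> real) set set"
  assumes nonlinear: "\<not> (\<exists>a b. \<forall>x\<in>{0..1}. F x = a * x + b)"
    and deriv: "\<And>x. x \<in> {0..1} \<Longrightarrow> (F has_real_derivative F' x) (at x within {0..1})"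
    and lipschitz: "\<exists>C. C-lipschitz_on {0..1} F"
    and luzin: "luzin_N_on {0..1} F'"
    and lines: "\<And>L. L \<in> X \<Longrightarrow> is_line L"
    and cover: "graph_on {0..1} F \<subseteq> \<Union>X"
  shows "hausdorff_dim (\<Union>X) = 2"
proof (rule hausdorff_dim_plane_eq_2)
  fix s :: real assume s: "0 \<le> s" "s < 2"
  define V where "V = {x \<in> {0..1}. \<forall>y. (x, y) \<in> \<Union>X}"
  have "\<exists>a. \<forall>z. (z, a * (z - x) + F x) \<in> \<Union>X" if x: "x \<in> {0..1} - V" for x
  proof -
    have "(x, F x) \<in> \<Union>X" using cover x unfolding graph_on_def by blast
    then obtain L where L: "L \<in> X" "(x, F x) \<in> L" by blast
    have "\<not> (\<forall>y. (x, y) \<in> L)" using x L unfolding V_def by blast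
    then show ?thesis using line_through_point[OF lines[OF L(1)] L(2)] L(1) by blast
  qed
  then obtain a where a: "\<And>x z. x \<in> {0..1} - V \<Longrightarrow> (z, a x * (z - x) + F x) \<in> \<Union>X" by metis
  define S where "S = {x \<in> {0..1} - V. a x \<noteq> F' x}"
  define T where "T = {x \<in> {0..1} - V. a x = F' x}"
  consider "\<not> negligible V" | "\<not> negligible S" | "negligible (V \<union> S)" by auto
  then show "hausdorff_measure s (\<Union>X) \<noteq> 0"
  proof cases
    case 1
    then show ?thesis
      by (rule hausdorff_measure_vertical_lines_nonzero[OF _ _ s]) (auto simp: V_def)
  next
    case 2
    obtain A c where A: "A \<subseteq> S" "\<not> negligible A" "0 < c"
      "\<And>x y. \<lbrakk>x \<in> A; y \<in> A\<rbrakk> \<Longrightarrow> c * \<bar>x - y\<bar> \<le> \<bar>F y - F x - a x * (y - x)\<bar>"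
      using transversal_separated_piece[of S "{0..1}" F F' a] 2 deriv unfolding S_def by blast
    show ?thesis
    proof (rule hausdorff_measure_union_of_lines_nonzero[OF A(2,3) _ _ s, of a "\<lambda>x. F x - a x * x"])
      fix x y assume xy: "x \<in> A" "y \<in> A"
      then have y: "0 \<le> y" "y \<le> 1" using A(1) unfolding S_def by auto
      have "\<bar>(a y - a x) * y\<bar> \<le> \<bar>a y - a x\<bar>" unfolding abs_mult using y by (intro mult_left_le) auto
      moreover have "F y - F x - a x * (y - x) = (a y - a x) * y + ((F y - a y * y) - (F x - a x * x))"
        by (simp add: algebra_simps)
      ultimately show "c * \<bar>x - y\<bar> \<le> \<bar>a x - a y\<bar> + \<bar>F x - a x * x - (F y - a y * y)\<bar>"
        using A(4)[OF xy] by linarith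
    next
      fix x z assume "x \<in> A"
      then have "(z, a x * (z - x) + F x) \<in> \<Union>X" using A(1) unfolding S_def by (intro a) auto
      then show "(z, a x * z + (F x - a x * x)) \<in> \<Union>X" by (simp add: algebra_simps)
    qed
  next
    case 3
    have "V \<union> S \<subseteq> {0..1}" unfolding V_def S_def by auto
    then have null: "negligible (F' ` (V \<union> S))"
      using luzin 3 unfolding luzin_N_on_def negligible_iff_null_sets by blast
    have "F' ` {0..1} \<subseteq> F' ` T \<union> F' ` (V \<union> S)" unfolding S_def T_def by auto
    then have A: "\<not> negligible (F' ` T)"
      using not_negligible_derivative_image[OF nonlinear deriv] null negligible_subset negligible_Un by metis
    \<comment> \<open>a point of tangency for each slope\<close>
    define g where "g = inv_into T F'"
    have g: "g t \<in> T" "F' (g t) = t" if "t \<in> F' ` T" for t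
      unfolding g_def using that by (auto intro: inv_into_into f_inv_into_f)
    show ?thesis
    proof (rule hausdorff_measure_union_of_lines_nonzero[OF A zero_less_one _ _ s, of "\<lambda>t. t" "\<lambda>t. F (g t) - t * g t"])
      fix t z assume "t \<in> F' ` T"
      note t = g[OF this]
      have "(z, a (g t) * (z - g t) + F (g t)) \<in> \<Union>X" using t(1) unfolding T_def by (intro a) auto
      moreover have "a (g t) = t" using t unfolding T_def by simp
      ultimately show "(z, t * z + (F (g t) - t * g t)) \<in> \<Union>X" by (simp add: algebra_simps)
    qed simp
  qed
qed

end
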